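(* Let $K$ be a field of characteristic zero, let $d \geq 1$ be an integer, let $I$ be an Artinian ideal in $R = K[x,y,z]$ generated by monomials whose degrees are bounded above by $d$, and let $T = T_d(I)$. If $T$ is non-empty, then any two of the following conditions imply the third: (i) $I$ is perfectly-punctured in degree $d$, i.e., $\mathfrak{o}_d(I) = 0$; (ii) $T$ is tileable; (iii) the syzygy bundle $\widetilde{\mathrm{syz}}\, I$ is semistable.
   Context: Triangular regions. For an integer $d \geq 1$, $\mathcal{T}_d$ is an equilateral triangle of side length $d$ subdivided into unit triangles: $\binom{d+1}{2}$ upward-pointing ones, labeled bijectively by the monomials of $R$ of degree $d-1$, and $\binom{d}{2}$ downward-pointing ones, labeled bijectively by the monomials of degree $d-2$, so that a downward-pointing triangle labeled $m$ shares an edge precisely with the upward-pointing triangles labeled $xm, ym, zm$. For a monomial ideal $I$, $T_d(I)$ is the set of unit triangles of $\mathcal{T}_d$ whose labels are not in $I$. A lozenge is a union of two unit triangles sharing an edge. A set of unit triangles is tileable if it is empty or can be partitioned into lozenges. Over-puncturing coefficient. $\mathfrak{o}_d(I) = \sum_g (d - \deg g) - d$, the sum being over the minimal monomial generators $g$ of $I$ of degree less than $d$ (generators of degree exactly $d$ would contribute $0$). $I$ is perfectly-punctured in degree $d$ if $\mathfrak{o}_d(I)=0$. Syzygy bundle. For an Artinian ideal $I$ of $R$ minimally generated by forms $f_1,\dots,f_m$, the module $\mathrm{syz}\, I$ is the kernel of $\bigoplus_{i=1}^m R(-\deg f_i) \to I$, and the syzygy bundle $\widetilde{\mathrm{syz}}\,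 I$ is its sheafification on $\mathbb{P}^2$, a vector bundle of rank $m-1$. A vector bundle $E$ is semistable if $\mu(F) \leq \mu(E)$ for every nonzero coherent subsheaf $F \subset E$, where $\mu = c_1/\mathrm{rk}$. For $I$ minimally generated by monomials $g_1,\dots,g_m$ over a field of characteristic zero, this is equivalent (theorem of Brenner), and may be taken as the definition, to: for every proper subset $J \subset \{1,\dots,m\}$ with $|J| \geq 2$, $\frac{d_J - \sum_{j\in J} \deg g_j}{|J|-1} \leq \frac{-\sum_{i=1}^m \deg g_i}{m-1}$, where $d_J = \deg \gcd\{g_j : j \in J\}$. *)

theory Defs
  imports Complex_Main "HOL-Library.Poly_Mapping" "HOL-Library.Disjoint_Sets"
begin

text \<open>
  The polynomial ring \<open>K[x,y,z]\<close> is the monoid algebra over \<open>K\<close> of the additive monoid of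
  exponent vectors; multiplication of monomials is addition of exponent vectors.
\<close>

datatype var = Vx | Vy | Vz

type_synonym mono = "var \<Rightarrow>\<^sub>0 nat"
type_synonym 'k mpoly3 = "mono \<Rightarrow>\<^sub>0 'k"

lemma UNIV_var: "(UNIV :: var set) = {Vx, Vy, Vz}"
  using var.exhaust by blast

instance var :: finite
  by standard (simp add: UNIV_var)

definition var_mono :: "var \<Rightarrow> mono" where
  "var_mono v = Poly_Mapping.single v 1"

definition to_poly :: "mono \<Rightarrow> 'k::comm_ring_1 mpoly3" where
  "to_poly m = Poly_Mapping.single m 1"

definition mdeg :: "mono \<Rightarrow> nat" where
  "mdeg m = (\<Sum>v\<in>UNIV. Poly_Mapping.lookup m v)"

definition mono_dvd :: "mono \<Rightarrow> mono \<Rightarrow> bool" where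
  "mono_dvd m n \<longleftrightarrow> (\<exists>k. n = m + k)"

definition mono_gcd :: "mono set \<Rightarrow> mono" where
  "mono_gcd J = Abs_poly_mapping (\<lambda>v. Min ((\<lambda>g. Poly_Mapping.lookup g v) ` J))"

text \<open>Ideals of a commutative ring are its submodules as a module over itself.\<close>

definition is_ideal :: "'a::comm_ring_1 set \<Rightarrow> bool" where
  "is_ideal A \<longleftrightarrow> module.subspace (*) A"

definition ideal_of :: "'a::comm_ring_1 set \<Rightarrow> 'a set" where
  "ideal_of B = module.span (*) B"

text \<open>
  An ideal \<open>I\<close> of \<open>R\<close> is Artinian if the ring \<open>R/I\<close> is. The ideals of \<open>R/I\<close> correspond to the ideals
  of \<open>R\<close> containing \<open>I\<close>, so this is the descending chain condition on the latter.
\<close>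

definition artinian_ideal :: "'a::comm_ring_1 set \<Rightarrow> bool" where
  "artinian_ideal I \<longleftrightarrow> is_ideal I \<and>
     (\<forall>A :: nat \<Rightarrow> 'a set.
        (\<forall>n. is_ideal (A n) \<and> I \<subseteq> A n \<and> A (Suc n) \<subseteq> A n) \<longrightarrow> (\<exists>N. \<forall>n\<ge>N. A n = A N))"

definition monomial_ideal :: "mono set \<Rightarrow> 'k::comm_ring_1 mpoly3 set" where
  "monomial_ideal S = ideal_of (to_poly ` S)"

definition minimally_generates :: "mono set \<Rightarrow> 'k::comm_ring_1 mpoly3 set \<Rightarrow> bool" where
  "minimally_generates G I \<longleftrightarrow>
     monomial_ideal G = I \<and> (\<forall>G'. G' \<subset> G \<longrightarrow> (monomial_ideal G' :: 'k mpoly3 set) \<noteq> I)"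

text \<open>
  A monomial ideal has exactly one minimal set of monomial generators; this is proved below as
  \<open>minimally_generates_iff\<close>, so the description is meaningful for every monomial ideal.
\<close>

definition mingens :: "'k::comm_ring_1 mpoly3 set \<Rightarrow> mono set" where
  "mingens I = (THE G. minimally_generates G I)"

definition overpuncturing :: "nat \<Rightarrow> 'k::comm_ring_1 mpoly3 set \<Rightarrow> int" where
  "overpuncturing d I = (\<Sum>g | g \<in> mingens I \<and> mdeg g < d. int d - int (mdeg g)) - int d"

text \<open>
  The unit triangles are represented by their labels. The degree conditions are written additively,
  so that there is no downward-pointing triangle for \<open>d = 1\<close>.
\<close>

datatype unit_triangle = Up (label: mono) | Down (label: mono)

definition triangle :: "nat \<Rightarrow> unit_triangle set" where
  "triangle d = {Up m | m. mdeg m + 1 = d} \<union> {Down m | m. mdeg m + 2 = d}"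

definition triangular_region :: "nat \<Rightarrow> 'k::comm_ring_1 mpoly3 set \<Rightarrow> unit_triangle set" where
  "triangular_region d I = {t \<in> triangle d. to_poly (label t) \<notin> I}"

definition lozenge :: "unit_triangle set \<Rightarrow> bool" where
  "lozenge L \<longleftrightarrow> (\<exists>m v. L = {Down m, Up (m + var_mono v)})"

definition tileable :: "unit_triangle set \<Rightarrow> bool" where
  "tileable T \<longleftrightarrow> T = {} \<or> (\<exists>P. partition_on T P \<and> (\<forall>L\<in>P. lozenge L))"

text \<open>
  Semistability of the syzygy bundle of an Artinian monomial ideal over a field of characteristic
  zero, through Brenner's criterion: the quotients are the slopes of the syzygy bundle
  (on the right) and of the subsheaves of syzygies of the generators in \<open>J\<close> (on the left).
\<close>

definition syzygy_bundle_semistable :: "'k::field_char_0 mpoly3 set \<Rightarrow> bool" where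
  "syzygy_bundle_semistable I \<longleftrightarrow>
     (\<forall>J. J \<subset> mingens I \<and> 2 \<le> card J \<longrightarrow>
        (real (mdeg (mono_gcd J)) - (\<Sum>g\<in>J. real (mdeg g))) / (real (card J) - 1)
        \<le> - (\<Sum>g\<in>mingens I. real (mdeg g)) / (real (card (mingens I)) - 1))"


subsection \<open>Well-definedness\<close>

lemma module_times: "module ((*) :: 'a::comm_ring_1 \<Rightarrow> 'a \<Rightarrow> 'a)"
  by unfold_locales (simp_all add: algebra_simps)

lemma lookup_mono_gcd: "Poly_Mapping.lookup (mono_gcd J) v = Min ((\<lambda>g. Poly_Mapping.lookup g v) ` J)"
  unfolding mono_gcd_def by (subst lookup_Abs_poly_mapping) simp_all

lemma mono_dvd_iff: "mono_dvd m n \<longleftrightarrow> (\<forall>v. Poly_Mapping.lookup m v \<le> Poly_Mapping.lookup n v)"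
proof
  assume "\<forall>v. Poly_Mapping.lookup m v \<le> Poly_Mapping.lookup n v"
  then have "n = m + (n - m)"
    by (intro poly_mapping_eqI) (simp add: lookup_add lookup_minus)
  then show "mono_dvd m n" unfolding mono_dvd_def by blast
qed (auto simp: mono_dvd_def lookup_add)

lemma mono_gcd_is_gcd:
  assumes "finite J" "J \<noteq> {}"
  shows "mono_dvd k (mono_gcd J) \<longleftrightarrow> (\<forall>g\<in>J. mono_dvd k g)"
  using assms by (auto simp: mono_dvd_iff lookup_mono_gcd)

lemma to_poly_in_monomial_ideal_iff:
  "(to_poly m :: 'k::comm_ring_1 mpoly3) \<in> monomial_ideal S \<longleftrightarrow> (\<exists>s\<in>S. mono_dvd s m)"
proof
  let ?A = "{p :: 'k mpoly3. \<forall>m\<in>Poly_Mapping.keys p. \<exists>s\<in>S. mono_dvd s m}"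
  have "module.subspace (*) ?A"
    unfolding module.subspace_def[OF module_times]
  proof (intro conjI ballI allI)
    fix p q :: "'k mpoly3" assume "p \<in> ?A" "q \<in> ?A"
    then show "p + q \<in> ?A" using keys_add[of p q] by blast
  next
    fix c p :: "'k mpoly3" assume p: "p \<in> ?A"
    show "c * p \<in> ?A"
    proof (intro CollectI ballI)
      fix n assume "n \<in> Poly_Mapping.keys (c * p)"
      then obtain a b where ab: "n = a + b" "b \<in> Poly_Mapping.keys p" using keys_mult[of c p] by blast
      then obtain s k where "s \<in> S" "b = s + k" using p by (auto simp: mono_dvd_def)
      then have "n = s + (a + k)" using ab by (simp add: ac_simps)
      then show "\<exists>s\<in>S. mono_dvd s n" using \<open>s \<in> S\<close> unfolding mono_dvd_def by blast
    qed
  qed simp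
  moreover have "to_poly ` S \<subseteq> ?A"
    by (auto simp: to_poly_def mono_dvd_iff)
  ultimately have "monomial_ideal S \<subseteq> ?A"
    unfolding monomial_ideal_def ideal_of_def by (intro module.span_minimal[OF module_times])
  moreover assume "(to_poly m :: 'k mpoly3) \<in> monomial_ideal S"
  ultimately show "\<exists>s\<in>S. mono_dvd s m" by (auto simp: to_poly_def)
next
  assume "\<exists>s\<in>S. mono_dvd s m"
  then obtain s k where "s \<in> S" and m: "m = s + k" by (auto simp: mono_dvd_def)
  then have "to_poly s \<in> (monomial_ideal S :: 'k mpoly3 set)"
    unfolding monomial_ideal_def ideal_of_def
    by (intro module.span_base[OF module_times]) simp
  then have "to_poly k * to_poly s \<in> (monomial_ideal S :: 'k mpoly3 set)"
    unfolding monomial_ideal_def ideal_of_def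
    by (intro module.span_scale[OF module_times])
  then show "(to_poly m :: 'k mpoly3) \<in> monomial_ideal S"
    by (simp add: to_poly_def mult_single m add.commute)
qed

lemma monomial_ideal_mono:
  "to_poly ` S \<subseteq> (monomial_ideal T :: 'k::comm_ring_1 mpoly3 set) \<Longrightarrow>
   (monomial_ideal S :: 'k mpoly3 set) \<subseteq> monomial_ideal T"
  unfolding monomial_ideal_def ideal_of_def
  by (intro module.span_minimal[OF module_times] module.subspace_span[OF module_times])

lemma mono_dvd_trans: "mono_dvd a b \<Longrightarrow> mono_dvd b c \<Longrightarrow> mono_dvd a c"
  unfolding mono_dvd_iff using le_trans by blast

lemma mono_dvd_antisym: "mono_dvd a b \<Longrightarrow> mono_dvd b a \<Longrightarrow> a = b"
  unfolding mono_dvd_iff by (intro poly_mapping_eqI) (simp add: order_antisym)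

lemma mono_dvd_mdeg: "mono_dvd a b \<Longrightarrow> a \<noteq> b \<Longrightarrow> mdeg a < mdeg b"
proof -
  assume ab: "mono_dvd a b" "a \<noteq> b"
  then obtain v where "Poly_Mapping.lookup a v \<noteq> Poly_Mapping.lookup b v" by (metis poly_mapping_eqI)
  with ab show "mdeg a < mdeg b" unfolding mdeg_def mono_dvd_iff
    by (intro sum_strict_mono_ex1) (auto intro!: exI[of _ v] simp: order_less_le)
qed

lemma minimally_generates_iff:
  fixes I :: "'k::comm_ring_1 mpoly3 set"
  assumes I: "I = monomial_ideal S"
  shows "minimally_generates G I \<longleftrightarrow>
    G = {g. to_poly g \<in> I \<and> (\<forall>h. to_poly h \<in> I \<and> mono_dvd h g \<longrightarrow> h = g)}"
    (is "_ \<longleftrightarrow> G = ?M")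
proof -
  have refl: "mono_dvd a a" for a by (simp add: mono_dvd_iff)
  have below: "\<exists>g\<in>?M. mono_dvd g m" if "to_poly m \<in> I" for m
    using that
  proof (induction m rule: measure_induct_rule[of mdeg])
    case (less m)
    show ?case
    proof (cases "m \<in> ?M")
      case False
      with less.prems obtain h where h: "to_poly h \<in> I" "mono_dvd h m" "h \<noteq> m" by blast
      with less.IH[OF mono_dvd_mdeg] show ?thesis by (meson mono_dvd_trans)
    qed (use refl in blast)
  qed
  have sub: "?M \<subseteq> H" if H: "monomial_ideal H = I" for H
  proof
    fix g assume g: "g \<in> ?M"
    then obtain h where h: "h \<in> H" "mono_dvd h g"
      unfolding H[symmetric] to_poly_in_monomial_ideal_iff by blast
    then have "to_poly h \<in> I"
      unfolding H[symmetric] to_poly_in_monomial_ideal_iff using refl by blast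
    with g h show "g \<in> H" by blast
  qed
  have gen: "monomial_ideal ?M = I"
  proof
    have "to_poly ` ?M \<subseteq> (monomial_ideal S :: 'k mpoly3 set)" using I by blast
    then show "monomial_ideal ?M \<subseteq> I" unfolding I by (rule monomial_ideal_mono)
    have "to_poly ` S \<subseteq> (monomial_ideal ?M :: 'k mpoly3 set)"
    proof (intro image_subsetI)
      fix s assume "s \<in> S"
      then have "(to_poly s :: 'k mpoly3) \<in> I"
        unfolding I to_poly_in_monomial_ideal_iff using refl by blast
      then show "(to_poly s :: 'k mpoly3) \<in> monomial_ideal ?M"
        unfolding to_poly_in_monomial_ideal_iff by (rule below)
    qed
    then show "I \<subseteq> monomial_ideal ?M" unfolding I by (rule monomial_ideal_mono)
  qed
  show ?thesis
  proof
    assume "minimally_generates G I"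
    then have "?M \<subseteq> G" "\<not> ?M \<subset> G"
      using sub gen unfolding minimally_generates_def by blast+
    then show "G = ?M" by blast
  next
    assume "G = ?M"
    then show "minimally_generates G I"
      unfolding minimally_generates_def using sub gen by blast
  qed
qed

lemma mingens_eq:
  fixes I :: "'k::comm_ring_1 mpoly3 set"
  assumes "I = monomial_ideal S"
  shows "mingens I = {g. to_poly g \<in> I \<and> (\<forall>h. to_poly h \<in> I \<and> mono_dvd h g \<longrightarrow> h = g)}"
  unfolding mingens_def minimally_generates_iff[OF assms] by (rule the_equality) simp_all

end

theory Submission
  imports Defs
begin

text \<open>
  Identify unit triangles with their labels, upward ones with monomials of degree \<open>d - 1\<close> and
  downward ones with monomials of degree \<open>d - 2\<close>. The labels in the ideal \<open>I\<close> form a set closed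
  under multiples, the union of the punctures: the generator \<open>g\<close> removes an upward triangle of side
  length \<open>d - mdeg g\<close>. The central quantity is the excess, the number of upward minus the number
  of downward unit triangles. It is additive on disjoint sets, it is \<open>k\<close> on an upward triangle of
  side length \<open>k\<close>, and a region can only be tiled if its excess is 0, that is, if the union of
  the punctures has excess \<open>d\<close>.

  On a set closed under multiples the excess counts how often the rows in a given direction enter
  the set, so it is at least the number of nonempty rows (\<open>excess_ge_rows\<close>). It follows that a
  union of triangles that contains two overlapping ones has, inside their hull, at least the
  excess of the hull (\<open>excess_ge_hull_of_overlap\<close>). Merging overlapping triangles into their hulls
  thus bounds the excess of any union from below by the sum of the side lengths of disjoint
  triangles (\<open>merge_overlapping\<close>).

  After a shift by \<open>d\<close>, Brenner's criterion compares the over-puncturing coefficients of the hulls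
  of sets of generators. If the coefficient of \<open>I\<close> is 0, it says that no hull contains punctures
  of total side length larger than its own. By merging, this yields Hall's condition for matching
  downward with upward triangles (\<open>semistable_imp_tileable\<close>). Conversely, a tiling with
  coefficient 0 forces the punctures to be disjoint, and their part inside any hull to have an
  excess of at most the side length of the hull (\<open>tileable_imp_semistable\<close>).

  A tiling makes the coefficient nonnegative; it measures what overlaps absorb. Suppose that it is
  positive and that there are \<open>m\<close> generators. By semistability, a cluster of \<open>c\<close> punctures absorbs
  at most the fraction \<open>(c - 1) / (m - 1)\<close> of it, so two or more separate clusters cannot absorb all
  of it. Hence no row is free of punctures, and then an excess of \<open>d\<close> leaves no gap in any row:
  the punctures cover everything, contrary to the region being nonempty
  (\<open>tileable_semistable_imp_over_eq_0\<close>).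
\<close>

section \<open>Monomials\<close>

abbreviation expo :: "mono \<Rightarrow> var \<Rightarrow> nat" where
  "expo \<equiv> Poly_Mapping.lookup"

definition multiples :: "mono set \<Rightarrow> mono set" where
  "multiples G = {m. \<exists>g\<in>G. mono_dvd g m}"

definition mult_closed :: "mono set \<Rightarrow> bool" where
  "mult_closed X \<longleftrightarrow> (\<forall>m\<in>X. \<forall>n. mono_dvd m n \<longrightarrow> n \<in> X)"

lemma mono_dvd_refl [simp]: "mono_dvd m m"
  by (simp add: mono_dvd_iff)

lemma mono_dvd_add [simp]: "mono_dvd m (m + k)"
  by (auto simp: mono_dvd_def)

lemma mdeg_add [simp]: "mdeg (m + n) = mdeg m + mdeg n"
  by (simp add: mdeg_def lookup_add sum.distrib)

lemma mdeg_zero [simp]: "mdeg 0 = 0"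
  by (simp add: mdeg_def)

lemma mdeg_single [simp]: "mdeg (Poly_Mapping.single v k) = k"
  by (simp add: mdeg_def lookup_single when_def)

lemma mdeg_var_mono [simp]: "mdeg (var_mono v) = 1"
  by (simp add: var_mono_def)

lemma expo_var_mono [simp]: "expo (var_mono v) w = (if v = w then 1 else 0)"
  by (simp add: var_mono_def lookup_single when_def)

lemma mdeg_le: "mono_dvd a b \<Longrightarrow> mdeg a \<le> mdeg b"
  by (auto simp: mono_dvd_def)

lemma expo_le_mdeg: "expo m v \<le> mdeg m"
  unfolding mdeg_def by (rule member_le_sum) auto

lemma mdeg_eq_0_iff [simp]: "mdeg m = 0 \<longleftrightarrow> m = 0"
  by (metis expo_le_mdeg le_zero_eq lookup_zero mdeg_zero poly_mapping_eqI)

lemma mdeg_1_cases: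
  assumes "mdeg k = 1"
  obtains v where "k = var_mono v"
proof -
  obtain v where v: "expo k v \<noteq> 0"
    using assms by (metis mdeg_eq_0_iff lookup_zero one_neq_zero poly_mapping_eqI)
  then have "mono_dvd (var_mono v) k" by (auto simp: mono_dvd_iff)
  with assms mono_dvd_mdeg[of "var_mono v" k] have "var_mono v = k" by fastforce
  with that show ?thesis by blast
qed

lemma mdeg_three:
  fixes v w t :: var
  assumes "distinct [v, w, t]"
  shows "mdeg m = expo m v + expo m w + expo m t"
proof -
  have U: "(UNIV :: var set) = {v, w, t}"
    using assms by (cases v; cases w; cases t) (auto simp: UNIV_var)
  have "mdeg m = sum (expo m) {v, w, t}"
    unfolding mdeg_def U ..
  also have "\<dots> = expo m v + expo m w + expo m t"
    using assms by simp
  finally show ?thesis .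
qed

lemma third_variable:
  fixes v w :: var
  assumes "v \<noteq> w"
  obtains t where "distinct [v, w, t]"
proof -
  have "\<exists>t. distinct [v, w, t]"
    by (rule exI[of _ "if Vx \<notin> {v, w} then Vx else if Vy \<notin> {v, w} then Vy else Vz"])
      (use assms in \<open>cases v; cases w; simp\<close>)
  with that show ?thesis by blast
qed

lemma two_other_variables:
  fixes v :: var
  obtains w t where "distinct [v, w, t]"
proof -
  obtain w where "v \<noteq> w" by (metis var.distinct(1))
  with that third_variable[of v w] show ?thesis by blast
qed

lemma mono_eqI_two_exponents:
  assumes "v \<noteq> w" "mdeg m = mdeg n" "expo m v = expo n v" "expo m w = expo n w"
  shows "m = n"
proof (rule poly_mapping_eqI)
  obtain t where t: "distinct [v, w, t]" using third_variable[OF assms(1)] .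
  fix u
  have "u \<in> {v, w, t}" using t by (cases u; cases v; cases w; cases t) auto
  moreover have "expo m t = expo n t" using assms mdeg_three[OF t, of m] mdeg_three[OF t, of n] by simp
  ultimately show "expo m u = expo n u" using assms by auto
qed

lemma finite_mdeg_le: "finite {m. mdeg m \<le> k}"
proof (rule finite_imageD)
  let ?f = "\<lambda>m. (mdeg m, expo m Vx, expo m Vy)"
  have "?f ` {m. mdeg m \<le> k} \<subseteq> {..k} \<times> {..k} \<times> {..k}"
    using expo_le_mdeg by (auto intro: order_trans)
  then show "finite (?f ` {m. mdeg m \<le> k})" by (rule finite_subset) auto
  show "inj_on ?f {m. mdeg m \<le> k}"
    by (rule inj_onI) (auto intro: mono_eqI_two_exponents[of Vx Vy])
qed

lemma multiples_closed [simp]: "mult_closed (multiples G)"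
  unfolding mult_closed_def multiples_def by (blast intro: mono_dvd_trans)

lemma mult_closedD: "mult_closed X \<Longrightarrow> m \<in> X \<Longrightarrow> mono_dvd m n \<Longrightarrow> n \<in> X"
  unfolding mult_closed_def by blast

lemma mult_closed_Int: "mult_closed X \<Longrightarrow> mult_closed Y \<Longrightarrow> mult_closed (X \<inter> Y)"
  unfolding mult_closed_def by blast

lemma multiples_insert: "multiples (insert g G) = multiples {g} \<union> multiples G"
  by (auto simp: multiples_def)

lemma multiples_Un: "multiples (F \<union> G) = multiples F \<union> multiples G"
  by (auto simp: multiples_def)

lemma multiple_of_degree:
  assumes "mdeg m \<le> k"
  obtains u where "mono_dvd m u" "mdeg u = k"
  using assms that[of "m + Poly_Mapping.single Vx (k - mdeg m)"] by simp


section \<open>The excess of upward over downward triangles\<close>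

text \<open>
  Inside a triangle of side length \<open>d\<close>, the labels in \<open>level d 1 X\<close> are those of upward and the
  labels in \<open>level d 2 X\<close> those of downward unit triangles. The degree condition is additive so
  that no label is produced by truncated subtraction.
\<close>

definition level :: "nat \<Rightarrow> nat \<Rightarrow> mono set \<Rightarrow> mono set" where
  "level d j X = {m \<in> X. mdeg m + j = d}"

definition excess :: "nat \<Rightarrow> mono set \<Rightarrow> int" where
  "excess d X = int (card (level d 1 X)) - int (card (level d 2 X))"

lemma finite_level [simp]: "finite (level d j X)"
  by (rule finite_subset[OF _ finite_mdeg_le[of d]]) (auto simp: level_def)

lemma excess_cong:
  assumes "\<And>m. mdeg m < d \<Longrightarrow> m \<in> X \<longleftrightarrow> m \<in> Y"
  shows "excess d X = excess d Y"
proof -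
  have "level d 1 X = level d 1 Y" "level d 2 X = level d 2 Y"
    using assms by (auto simp: level_def)
  then show ?thesis by (simp add: excess_def)
qed

lemma excess_empty [simp]: "excess d {} = 0"
  by (simp add: excess_def level_def)

lemma excess_Un_Int: "excess d (X \<union> Y) + excess d (X \<inter> Y) = excess d X + excess d Y"
proof -
  have "card (level d j (X \<union> Y)) + card (level d j (X \<inter> Y)) = card (level d j X) + card (level d j Y)" for j
  proof -
    have "level d j (X \<union> Y) = level d j X \<union> level d j Y" "level d j (X \<inter> Y) = level d j X \<inter> level d j Y"
      by (auto simp: level_def)
    then show ?thesis using card_Un_Int[of "level d j X" "level d j Y"] by simp
  qed
  from this[of 1] this[of 2] show ?thesis unfolding excess_def by linarith
qed

lemma excess_Un_disjoint:
  assumes "\<And>m. m \<in> X \<Longrightarrow> m \<in> Y \<Longrightarrow> d \<le> mdeg m"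
  shows "excess d (X \<union> Y) = excess d X + excess d Y"
proof -
  have "excess d (X \<inter> Y) = excess d {}"
    by (rule excess_cong) (use assms in force)
  with excess_Un_Int[of d X Y] show ?thesis by simp
qed

text \<open>
  In a set closed under multiples, move every downward triangle to the upward triangle that it
  shares an edge with in direction \<open>w\<close>. The excess counts the upward triangles that are left over.
  For any other variable \<open>v\<close>, the unit triangles whose labels have a fixed exponent in \<open>v\<close> form a
  row, and what is left over in it are the places where the row enters the set as the exponent in
  \<open>w\<close> grows. This is the source of all lower bounds below.
\<close>

definition entries :: "nat \<Rightarrow> var \<Rightarrow> mono set \<Rightarrow> mono set" where
  "entries d w X = {u \<in> level d 1 X. \<forall>n\<in>X. u \<noteq> n + var_mono w}"

lemma finite_entries [simp]: "finite (entries d w X)"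
  by (rule finite_subset[OF _ finite_level[of d 1 X]]) (auto simp: entries_def)

lemma excess_eq_card_entries:
  assumes "mult_closed X"
  shows "excess d X = int (card (entries d w X))"
proof -
  let ?S = "(\<lambda>n. n + var_mono w) ` level d 2 X"
  have sub: "?S \<subseteq> level d 1 X"
    using assms by (auto simp: level_def intro: mult_closedD)
  have "entries d w X = level d 1 X - ?S"
    by (auto simp: entries_def level_def)
  then have "card (entries d w X) = card (level d 1 X) - card ?S"
    using sub by (simp add: card_Diff_subset)
  moreover have "card ?S = card (level d 2 X)"
    by (rule card_image) (auto intro: inj_onI)
  moreover have "card ?S \<le> card (level d 1 X)" using sub by (simp add: card_mono)
  ultimately show ?thesis by (simp add: excess_def)
qed

lemma excess_nonneg: "mult_closed X \<Longrightarrow> 0 \<le> excess d X"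
  by (simp add: excess_eq_card_entries[of X d Vx])

text \<open>
  The leftmost element of a row right of a gap is an entry: if it were \<open>n + var_mono w\<close> for \<open>n\<close>
  in the set, the other upward neighbour of the downward triangle \<open>n\<close> in the same row would be
  in the set too, and further left. With \<open>k = 0\<close> this gives an entry in every nonempty row.
\<close>

lemma entry_of_row:
  assumes X: "mult_closed X" and a: "a \<in> level d 1 X" and vw: "v \<noteq> w"
    and gap: "\<And>m. m \<in> level d 1 X \<Longrightarrow> expo m v = expo a v \<Longrightarrow> Suc (expo m w) \<noteq> k"
    and k: "k \<le> expo a w"
  obtains u where "u \<in> entries d w X" "expo u v = expo a v" "k \<le> expo u w" "expo u w \<le> expo a w"
proof -
  let ?P = "\<lambda>m. m \<in> level d 1 X \<and> expo m v = expo a v \<and> k \<le> expo m w"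
  have "?P a" using a k by auto
  then obtain u where u: "?P u" and min: "\<And>m. ?P m \<Longrightarrow> expo u w \<le> expo m w"
    using ex_has_least_nat[of ?P a "\<lambda>m. expo m w"] by blast
  obtain t where t: "distinct [v, w, t]" using third_variable[OF vw] .
  have "u \<noteq> n + var_mono w" if n: "n \<in> X" for n
  proof
    assume eq: "u = n + var_mono w"
    have lev: "n + var_mono t \<in> level d 1 X"
      using u eq n X by (auto simp: level_def intro: mult_closedD)
    have "expo (n + var_mono t) v = expo a v" "Suc (expo (n + var_mono t) w) = expo u w"
      using u eq t by (auto simp: lookup_add)
    with lev u gap[of "n + var_mono t"] min[of "n + var_mono t"] show False by fastforce
  qed
  with u have "u \<in> entries d w X" by (auto simp: entries_def)
  with u min[OF \<open>?P a\<close>] that show ?thesis by blast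
qed


text \<open>The rows that a triangle of side length \<open>d - mdeg g\<close> meets.\<close>

lemma multiple_in_row:
  assumes "expo g v \<le> i" "i + mdeg g < d + expo g v"
  obtains u where "mono_dvd g u" "mdeg u + 1 = d" "expo u v = i"
proof -
  obtain w t where vwt: "distinct [v, w, t]" using two_other_variables[of v] .
  let ?u = "g + (Poly_Mapping.single v (i - expo g v) + Poly_Mapping.single w (d - 1 - mdeg g - (i - expo g v)))"
  have "mono_dvd g ?u" "expo ?u v = i"
    using vwt assms by (auto simp: lookup_add lookup_single when_def)
  moreover have "mdeg ?u + 1 = d" using assms by simp
  ultimately show ?thesis using that by blast
qed

text \<open>Every nonempty row is entered at least once.\<close>

lemma excess_ge_rows:
  assumes X: "mult_closed X" and R: "\<And>i. i \<in> R \<Longrightarrow> \<exists>a\<in>level d 1 X. expo a v = i"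
  shows "int (card R) \<le> excess d X"
proof -
  obtain w t where vwt: "distinct [v, w, t]" using two_other_variables[of v] .
  have "R \<subseteq> (\<lambda>u. expo u v) ` entries d w X"
  proof
    fix i assume "i \<in> R"
    then obtain a where a: "a \<in> level d 1 X" "expo a v = i" using R by blast
    show "i \<in> (\<lambda>u. expo u v) ` entries d w X"
      by (rule entry_of_row[OF X a(1), of v w 0]) (use vwt a in auto)
  qed
  then have "card R \<le> card (entries d w X)" by (rule surj_card_le[rotated]) simp
  then show ?thesis using excess_eq_card_entries[OF X, of d w] by simp
qed

text \<open>A row with a gap is entered twice.\<close>

lemma excess_gt_rows:
  assumes X: "mult_closed X" and R: "\<And>i. i \<in> R \<Longrightarrow> \<exists>a\<in>level d 1 X. expo a v = i" and "v \<noteq> w"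
    and a: "a \<in> level d 1 X" and b: "b \<in> level d 1 X" and c: "c \<notin> X" "mdeg c + 1 = d"
    and row: "expo a v = expo c v" "expo b v = expo c v"
    and between: "expo a w < expo c w" "expo c w < expo b w"
  shows "int (card R) < excess d X"
proof -
  obtain e1 where e1: "e1 \<in> entries d w X" "expo e1 v = expo c v" "expo e1 w \<le> expo a w"
    by (rule entry_of_row[OF X a \<open>v \<noteq> w\<close>, of 0]) (use row in auto)
  have gap: "Suc (expo m w) \<noteq> Suc (expo c w)" if "m \<in> level d 1 X" "expo m v = expo b v" for m
    using that row c mono_eqI_two_exponents[OF \<open>v \<noteq> w\<close>, of m c] by (auto simp: level_def)
  obtain e2 where e2: "e2 \<in> entries d w X" "expo e2 v = expo c v" "Suc (expo c w) \<le> expo e2 w"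
    by (rule entry_of_row[OF X b \<open>v \<noteq> w\<close> gap]) (use row between in auto)
  have "R \<subseteq> (\<lambda>u. expo u v) ` (entries d w X - {e2})"
  proof
    fix i assume "i \<in> R"
    then obtain a' where a': "a' \<in> level d 1 X" "expo a' v = i" using R by blast
    obtain u where u: "u \<in> entries d w X" "expo u v = i"
      by (rule entry_of_row[OF X a'(1) \<open>v \<noteq> w\<close>, of 0]) (use a' in auto)
    show "i \<in> (\<lambda>u. expo u v) ` (entries d w X - {e2})"
    proof (cases "u = e2")
      case True
      then have "expo e1 v = i" "e1 \<noteq> e2" using u e1 e2 between by auto
      with e1 show ?thesis by blast
    qed (use u in blast)
  qed
  then have "card R \<le> card (entries d w X - {e2})" by (rule surj_card_le[rotated]) simp
  also have "\<dots> < card (entries d w X)" using e2(1) by (intro card_Diff1_less) auto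
  finally show ?thesis using excess_eq_card_entries[OF X, of d w] by simp
qed

lemma excess_pos:
  assumes "mult_closed X" "m \<in> X" "mdeg m < d"
  shows "0 < excess d X"
proof -
  obtain u where "mono_dvd m u" "mdeg u = d - 1"
    using multiple_of_degree[of m "d - 1"] assms(3) by force
  with assms have "u \<in> level d 1 X" by (auto simp: level_def intro: mult_closedD)
  then have "int (card {expo u Vx}) \<le> excess d X"
    by (intro excess_ge_rows[OF assms(1), where v = Vx]) blast
  then show ?thesis by simp
qed

text \<open>
  In a single triangle the entries are the upward unit triangles along one side, one in each row.
\<close>

lemma excess_multiples_singleton: "excess d (multiples {g}) = int (d - mdeg g)"
proof -
  let ?X = "multiples {g}" and ?R = "{expo g Vx..<expo g Vx + (d - mdeg g)}"
  have entry: "expo u Vy = expo g Vy" if u: "u \<in> entries d Vy ?X" for u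
  proof (rule ccontr)
    assume ne: "expo u Vy \<noteq> expo g Vy"
    have gu: "mono_dvd g u" using u by (auto simp: entries_def level_def multiples_def)
    with ne have lt: "expo g Vy < expo u Vy" by (metis le_neq_implies_less mono_dvd_iff)
    have "u = (u - var_mono Vy) + var_mono Vy"
      using lt by (intro poly_mapping_eqI) (auto simp: lookup_add lookup_minus)
    moreover have "mono_dvd g (u - var_mono Vy)"
      using lt gu by (auto simp: mono_dvd_iff lookup_minus)
    ultimately show False using u by (auto simp: entries_def multiples_def)
  qed
  have "inj_on (\<lambda>u. expo u Vx) (entries d Vy ?X)"
  proof (rule inj_onI)
    fix u u' assume *: "u \<in> entries d Vy ?X" "u' \<in> entries d Vy ?X" "expo u Vx = expo u' Vx"
    then have "mdeg u = mdeg u'" by (auto simp: entries_def level_def)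
    with * show "u = u'" using entry[of u] entry[of u'] by (auto intro: mono_eqI_two_exponents[of Vx Vy])
  qed
  moreover have "(\<lambda>u. expo u Vx) ` entries d Vy ?X \<subseteq> ?R"
  proof (rule image_subsetI)
    fix u assume u: "u \<in> entries d Vy ?X"
    then have "mono_dvd g u" "mdeg u + 1 = d" by (auto simp: entries_def level_def multiples_def)
    then obtain k where "u = g + k" "mdeg g + mdeg k + 1 = d" by (auto simp: mono_dvd_def)
    then show "expo u Vx \<in> ?R" using expo_le_mdeg[of k Vx] by (simp add: lookup_add)
  qed
  ultimately have "card (entries d Vy ?X) \<le> card ?R" by (intro card_inj_on_le) auto
  moreover have "int (card ?R) \<le> excess d ?X"
  proof (rule excess_ge_rows[where v = Vx])
    fix i assume "i \<in> ?R"
    then have "expo g Vx \<le> i" "i + mdeg g < d + expo g Vx" by auto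
    then obtain u where "mono_dvd g u" "mdeg u + 1 = d" "expo u Vx = i"
      by (rule multiple_in_row)
    then show "\<exists>a\<in>level d 1 ?X. expo a Vx = i" by (auto simp: level_def multiples_def)
  qed simp
  ultimately show ?thesis using excess_eq_card_entries[of ?X d Vy] by simp
qed


section \<open>Overlapping triangles\<close>

text \<open>
  The multiples of \<open>g\<close> form a triangle of side length \<open>d - mdeg g\<close>. The multiples of the greatest
  common divisor of a set of monomials form the smallest upward triangle containing all of their
  triangles, here called the hull. Two triangles
  overlap if they have a unit triangle in common; touching along an edge or at a corner is allowed.
\<close>

definition overlap :: "nat \<Rightarrow> mono \<Rightarrow> mono \<Rightarrow> bool" where
  "overlap d g h \<longleftrightarrow> (\<exists>m. mono_dvd g m \<and> mono_dvd h m \<and> mdeg m < d)"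

lemma overlap_sym: "overlap d g h \<Longrightarrow> overlap d h g"
  by (auto simp: overlap_def)

lemma excess_multiples_insert:
  "excess d (multiples (insert g G)) + excess d (multiples {g} \<inter> multiples G)
    = int (d - mdeg g) + excess d (multiples G)"
  using excess_Un_Int[of d "multiples {g}" "multiples G"]
  by (simp add: multiples_insert[of g G] excess_multiples_singleton)

lemma excess_multiples_le:
  assumes "finite G"
  shows "excess d (multiples G) \<le> (\<Sum>g\<in>G. int (d - mdeg g))"
  using assms
proof induction
  case empty
  then show ?case by (simp add: multiples_def)
next
  case (insert g G)
  then show ?case
    using excess_multiples_insert[of d g G] excess_nonneg[of "multiples {g} \<inter> multiples G" d]
    by (simp add: mult_closed_Int)
qed

text \<open>
  An overlap is counted twice by the sum of the side lengths, and its own excess is positive.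
\<close>

lemma excess_multiples_less:
  assumes "finite G" "g \<in> G" "h \<in> G" "g \<noteq> h" "overlap d g h"
  shows "excess d (multiples G) < (\<Sum>g\<in>G. int (d - mdeg g))"
proof -
  let ?G = "G - {g}"
  obtain m where "mono_dvd g m" "mono_dvd h m" "mdeg m < d" using assms(5) by (auto simp: overlap_def)
  then have "0 < excess d (multiples {g} \<inter> multiples ?G)"
    using assms(3,4) by (intro excess_pos[of _ m] mult_closed_Int multiples_closed) (auto simp: multiples_def)
  moreover have "insert g ?G = G" using assms(2) by blast
  ultimately have "excess d (multiples G) < int (d - mdeg g) + excess d (multiples ?G)"
    using excess_multiples_insert[of d g ?G] by simp
  also have "\<dots> \<le> int (d - mdeg g) + (\<Sum>g\<in>?G. int (d - mdeg g))"
    using assms(1) excess_multiples_le[of ?G d] by simp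
  also have "\<dots> = (\<Sum>g\<in>G. int (d - mdeg g))"
    using assms(1,2) by (simp add: sum.remove)
  finally show ?thesis .
qed

lemma excess_multiples_eq:
  assumes "finite G" "\<And>g h. g \<in> G \<Longrightarrow> h \<in> G \<Longrightarrow> g \<noteq> h \<Longrightarrow> \<not> overlap d g h"
  shows "excess d (multiples G) = (\<Sum>g\<in>G. int (d - mdeg g))"
  using assms
proof induction
  case empty
  then show ?case by (simp add: multiples_def)
next
  case (insert g G)
  have "\<not> mdeg m < d" if "m \<in> multiples {g}" "m \<in> multiples G" for m
    using that insert.prems[of g] insert.hyps(2) by (fastforce simp: multiples_def overlap_def)
  then have "excess d (multiples {g} \<union> multiples G) = excess d (multiples {g}) + excess d (multiples G)"
    by (intro excess_Un_disjoint) (meson not_le)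
  then show ?case using insert
    by (simp add: multiples_insert[of g G] excess_multiples_singleton)
qed

lemma lookup_gcd_pair: "expo (mono_gcd {g, h}) v = min (expo g v) (expo h v)"
  by (simp add: lookup_mono_gcd)

text \<open>
  In two of the three directions the same triangle \<open>h\<close> reaches as far as the hull. Its rows in
  the third direction are then the last rows of the hull, and since the triangles overlap, the
  rows of \<open>g\<close> fill the remaining ones.
\<close>

lemma excess_ge_hull_directed:
  assumes X: "mult_closed X" "g \<in> X" "h \<in> X" and ov: "overlap d g h"
    and vwt: "distinct [v, w, t]" and le: "expo h w \<le> expo g w" "expo h t \<le> expo g t"
  shows "int (d - mdeg (mono_gcd {g, h})) \<le> excess d X"
proof -
  define p where "p = mono_gcd {g, h}"
  let ?R = "{expo p v..<expo p v + (d - mdeg p)}"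
  obtain m where m: "mono_dvd g m" "mono_dvd h m" "mdeg m < d" using ov by (auto simp: overlap_def)
  note deg = mdeg_three[OF vwt]
  have p: "expo p v = min (expo g v) (expo h v)" "expo p w = expo h w" "expo p t = expo h t"
    using le by (auto simp: p_def lookup_gcd_pair)
  have "int (card ?R) \<le> excess d X"
  proof (rule excess_ge_rows[where v = v, OF X(1)])
    fix i assume i: "i \<in> ?R"
    have "expo g v \<le> expo m v" "expo g w \<le> expo m w" "expo g t \<le> expo m t" "expo h v \<le> expo m v"
      using m by (auto simp: mono_dvd_iff)
    then have "(expo g v \<le> i \<and> i + mdeg g < d + expo g v) \<or> (expo h v \<le> i \<and> i + mdeg h < d + expo h v)"
      using i m(3) p deg[of g] deg[of h] deg[of p] deg[of m] by auto
    then obtain f u where "f \<in> X" "mono_dvd f u" "mdeg u + 1 = d" "expo u v = i"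
      using multiple_in_row X(2,3) by metis
    then show "\<exists>a\<in>level d 1 X. expo a v = i" using X(1) by (auto simp: level_def intro: mult_closedD)
  qed
  then show ?thesis by (simp add: p_def)
qed

text \<open>
  Each of the three exponents of the greatest common divisor is attained by \<open>g\<close> or by \<open>h\<close>, so one
  of the two attains two of them.
\<close>

lemma excess_ge_hull_of_overlap:
  assumes X: "mult_closed X" "g \<in> X" "h \<in> X" and ov: "overlap d g h"
  shows "int (d - mdeg (mono_gcd {g, h})) \<le> excess d X"
proof -
  have 1: ?thesis if "distinct [v, w, t]" "expo h w \<le> expo g w" "expo h t \<le> expo g t" for v w t
    using excess_ge_hull_directed[OF X ov that] .
  have 2: ?thesis if "distinct [v, w, t]" "expo g w \<le> expo h w" "expo g t \<le> expo h t" for v w t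
    using excess_ge_hull_directed[OF X(1,3,2) overlap_sym[OF ov] that] by (simp add: insert_commute)
  show ?thesis
    using 1[of Vx Vy Vz] 1[of Vy Vx Vz] 1[of Vz Vx Vy] 2[of Vx Vy Vz] 2[of Vy Vx Vz] 2[of Vz Vx Vy]
    by (metis (no_types) distinct_length_2_or_more distinct_singleton var.distinct nle_le)
qed

lemma gcd_pair_dvd: "mono_dvd k (mono_gcd {g, h}) \<longleftrightarrow> mono_dvd k g \<and> mono_dvd k h"
  using mono_gcd_is_gcd[of "{g, h}" k] by simp

text \<open>
  Replace two overlapping triangles by their hull until no overlap is left. Apply
  \<open>excess_ge_hull_of_overlap\<close> to the part of the union inside the hull: filling the hull does not
  increase the excess of the union. At the end nothing overlaps, so the excess is the sum of the side
  lengths. Each resulting triangle is the hull of the original triangles in it.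
\<close>

lemma merge_overlapping:
  assumes "finite G"
  obtains H where "finite H"
    and "\<And>g. g \<in> G \<Longrightarrow> \<exists>h\<in>H. mono_dvd h g"
    and "\<And>h. h \<in> H \<Longrightarrow> \<exists>g\<in>G. mono_dvd h g"
    and "\<And>h k. h \<in> H \<Longrightarrow> (\<And>g. g \<in> G \<Longrightarrow> mono_dvd h g \<Longrightarrow> mono_dvd k g) \<Longrightarrow> mono_dvd k h"
    and "\<And>h h'. h \<in> H \<Longrightarrow> h' \<in> H \<Longrightarrow> h \<noteq> h' \<Longrightarrow> \<not> overlap d h h'"
    and "(\<Sum>h\<in>H. int (d - mdeg h)) \<le> excess d (multiples G)"
proof -
  let ?merged = "\<lambda>G H. finite H \<and> (\<forall>g\<in>G. \<exists>h\<in>H. mono_dvd h g) \<and> (\<forall>h\<in>H. \<exists>g\<in>G. mono_dvd h g) \<and>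
    (\<forall>h\<in>H. \<forall>k. (\<forall>g\<in>G. mono_dvd h g \<longrightarrow> mono_dvd k g) \<longrightarrow> mono_dvd k h) \<and>
    (\<forall>h\<in>H. \<forall>h'\<in>H. h \<noteq> h' \<longrightarrow> \<not> overlap d h h') \<and>
    (\<Sum>h\<in>H. int (d - mdeg h)) \<le> excess d (multiples G)"
  have "\<exists>H. ?merged G H"
    using assms
  proof (induction G rule: measure_induct_rule[of card])
    case (less G)
    show ?case
    proof (cases "\<exists>g\<in>G. \<exists>h\<in>G. g \<noteq> h \<and> overlap d g h")
      case False
      moreover have "(\<Sum>h\<in>G. int (d - mdeg h)) \<le> excess d (multiples G)"
        using excess_multiples_eq[of G d] False less.prems by fastforce
      ultimately have "?merged G G" using less.prems mono_dvd_refl by blast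
      then show ?thesis ..
    next
      case True
      then obtain g h where gh: "g \<in> G" "h \<in> G" "g \<noteq> h" "overlap d g h" by blast
      let ?p = "mono_gcd {g, h}" and ?G = "G - {g, h}"
      have p: "mono_dvd ?p g" "mono_dvd ?p h" using gcd_pair_dvd[of ?p g h] by simp_all
      have "card (insert ?p ?G) \<le> Suc (card ?G)" by (rule card_insert_le_m1) auto
      also have "card ?G = card G - 2" using gh less.prems by (simp add: card_Diff_subset)
      also have "Suc (card G - 2) < card G"
        using card_mono[of G "{g, h}"] gh less.prems by simp
      finally obtain H where H: "?merged (insert ?p ?G) H"
        using less.IH[of "insert ?p ?G"] less.prems by auto
      have "multiples (insert ?p ?G) = multiples {?p} \<union> multiples G"
        using p by (auto simp: multiples_def intro: mono_dvd_trans)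
      then have "excess d (multiples (insert ?p ?G)) + excess d (multiples {?p} \<inter> multiples G)
          = int (d - mdeg ?p) + excess d (multiples G)"
        using excess_Un_Int[of d "multiples {?p}" "multiples G"] by (simp add: excess_multiples_singleton)
      moreover have "int (d - mdeg ?p) \<le> excess d (multiples {?p} \<inter> multiples G)"
        using gh p by (intro excess_ge_hull_of_overlap mult_closed_Int multiples_closed) (auto simp: multiples_def intro: mono_dvd_refl)
      ultimately have ex: "(\<Sum>h\<in>H. int (d - mdeg h)) \<le> excess d (multiples G)" using H by linarith
      from H have below: "\<forall>f\<in>insert ?p ?G. \<exists>h\<in>H. mono_dvd h f"
        by (elim conjE)
      from H have above: "\<forall>h'\<in>H. \<exists>f\<in>insert ?p ?G. mono_dvd h' f"
        by (elim conjE)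
      from H have gcd: "\<forall>h'\<in>H. \<forall>k. (\<forall>f\<in>insert ?p ?G. mono_dvd h' f \<longrightarrow> mono_dvd k f) \<longrightarrow> mono_dvd k h'"
        by (elim conjE)
      have "\<exists>h\<in>H. mono_dvd h f" if f: "f \<in> G" for f
      proof (cases "f \<in> {g, h}")
        case True
        then have "mono_dvd ?p f" using p by auto
        moreover obtain h' where "h' \<in> H" "mono_dvd h' ?p" using below by blast
        ultimately show ?thesis using mono_dvd_trans[of h' ?p f] by blast
      next
        case False
        with f have "f \<in> insert ?p ?G" by simp
        with below show ?thesis by (rule bspec)
      qed
      moreover have "\<exists>f\<in>G. mono_dvd h' f" if h': "h' \<in> H" for h'
      proof -
        obtain f where f: "f \<in> insert ?p ?G" "mono_dvd h' f" using above h' by blast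
        show ?thesis
        proof (cases "f = ?p")
          case True
          with f(2) have "mono_dvd h' g" using mono_dvd_trans[of h' ?p g] p(1) by simp
          with gh(1) show ?thesis by (rule bexI[rotated])
        next
          case False
          with f(1) have "f \<in> G" by simp
          with f(2) show ?thesis by (rule bexI)
        qed
      qed
      moreover have "mono_dvd k h'"
        if h': "h' \<in> H" and k: "\<forall>f\<in>G. mono_dvd h' f \<longrightarrow> mono_dvd k f" for h' k
      proof (rule gcd[rule_format, OF h'])
        fix f assume f: "f \<in> insert ?p ?G" "mono_dvd h' f"
        show "mono_dvd k f"
        proof (cases "f = ?p")
          case True
          then have "mono_dvd h' g" "mono_dvd h' h" using f(2) gcd_pair_dvd by simp_all
          then show ?thesis using True k gh(1,2) gcd_pair_dvd by simp
        next
          case False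
          with f(1) have "f \<in> G" by simp
          with f(2) k show ?thesis by simp
        qed
      qed
      ultimately show ?thesis using H ex by (intro exI[of _ H]) simp
    qed
  qed
  then obtain H where "?merged G H" ..
  then show ?thesis using that[of H] by blast
qed


section \<open>Tilings and matchings\<close>

text \<open>
  Hall's marriage theorem by induction on the number of elements to be matched. If some proper
  subset has no more neighbours than elements, match this subset first and then the rest with
  the remaining neighbours; otherwise any single choice leaves Hall's condition intact.
\<close>

lemma hall_marriage:
  fixes N :: "'a \<Rightarrow> 'b set"
  assumes "finite A" "\<And>a. a \<in> A \<Longrightarrow> finite (N a)"
    and "\<And>D. D \<subseteq> A \<Longrightarrow> card D \<le> card (\<Union>(N ` D))"
  shows "\<exists>f. inj_on f A \<and> (\<forall>a\<in>A. f a \<in> N a)"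
  using assms
proof (induction A arbitrary: N rule: measure_induct_rule[of card])
  case (less A)
  note finA = less.prems(1) and finN = less.prems(2) and hall = less.prems(3)
  have finU: "finite (\<Union>(N ` D))" if "D \<subseteq> A" for D
    using that finA finN by (auto intro: finite_subset)
  show ?case
  proof (cases "\<exists>D\<subset>A. D \<noteq> {} \<and> card (\<Union>(N ` D)) = card D")
    case True
    then obtain D where D: "D \<subset> A" "D \<noteq> {}" "card (\<Union>(N ` D)) = card D" by blast
    let ?M = "\<lambda>a. N a - \<Union>(N ` D)"
    have "card D < card A" using D finA by (simp add: psubset_card_mono)
    moreover have "D \<subseteq> A" using D by blast
    ultimately have "\<exists>f. inj_on f D \<and> (\<forall>a\<in>D. f a \<in> N a)"
      using finA by (intro less.IH finN hall) (auto intro: finite_subset)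
    then obtain f where f: "inj_on f D" "\<forall>a\<in>D. f a \<in> N a" by blast
    have "card E \<le> card (\<Union>(?M ` E))" if E: "E \<subseteq> A - D" for E
    proof -
      have fin: "finite E" "finite D" using E D finA by (auto intro: finite_subset)
      have un: "\<Union>(N ` (E \<union> D)) = \<Union>(?M ` E) \<union> \<Union>(N ` D)" by blast
      have "finite (\<Union>(?M ` E))" "finite (\<Union>(N ` D))"
        using finU[of E] finU[of D] E D by (auto intro: finite_subset[of _ "\<Union>(N ` E)"])
      moreover have "\<Union>(?M ` E) \<inter> \<Union>(N ` D) = {}" by blast
      ultimately have "card (\<Union>(N ` (E \<union> D))) = card (\<Union>(?M ` E)) + card D"
        unfolding un D(3)[symmetric] by (rule card_Un_disjoint)
      moreover have "card (E \<union> D) = card E + card D" using E fin by (intro card_Un_disjoint) auto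
      moreover have "card (E \<union> D) \<le> card (\<Union>(N ` (E \<union> D)))" using E D by (intro hall) auto
      ultimately show ?thesis by simp
    qed
    moreover have "card (A - D) < card A" using D finA by (intro psubset_card_mono) auto
    ultimately have "\<exists>g. inj_on g (A - D) \<and> (\<forall>a\<in>A - D. g a \<in> ?M a)"
      using finA finN by (intro less.IH) auto
    then obtain g where g: "inj_on g (A - D)" "\<forall>a\<in>A - D. g a \<in> ?M a" by blast
    let ?h = "\<lambda>a. if a \<in> D then f a else g a"
    have "f a \<noteq> g b" if "a \<in> D" "b \<in> A - D" for a b
      using f(2) g(2) that by fastforce
    then have "f ` D \<inter> g ` (A - D) = {}" by blast
    then have "inj_on ?h (D \<union> (A - D))" by (rule inj_on_disjoint_Un[OF f(1) g(1)])
    moreover have "D \<union> (A - D) = A" using D(1) by blast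
    ultimately have "inj_on ?h A" by simp
    moreover have "\<forall>a\<in>A. ?h a \<in> N a" using f g by auto
    ultimately show ?thesis by blast
  next
    case no_tight: False
    show ?thesis
    proof (cases "A = {}")
      case False
      then obtain a where a: "a \<in> A" by blast
      have "card {a} \<le> card (N a)" using hall[of "{a}"] a by simp
      then obtain b where b: "b \<in> N a" by fastforce
      let ?M = "\<lambda>x. N x - {b}"
      have "card D \<le> card (\<Union>(?M ` D))" if D: "D \<subseteq> A - {a}" for D
      proof (cases "D = {}")
        case False
        have "D \<subset> A" using D a by blast
        then have "card (\<Union>(N ` D)) \<noteq> card D" using no_tight False by blast
        then have "card D < card (\<Union>(N ` D))" using hall[of D] \<open>D \<subset> A\<close> by auto
        moreover have "\<Union>(?M ` D) = \<Union>(N ` D) - {b}" by blast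
        ultimately show ?thesis by (auto simp: card_Diff_singleton_if)
      qed simp
      moreover have "card (A - {a}) < card A" using a finA by (intro psubset_card_mono) auto
      ultimately have "\<exists>f. inj_on f (A - {a}) \<and> (\<forall>x\<in>A - {a}. f x \<in> ?M x)"
        using finA finN by (intro less.IH) auto
      then obtain f where f: "inj_on f (A - {a})" "\<forall>x\<in>A - {a}. f x \<in> ?M x" by blast
      have "b \<notin> f ` (A - {a})" using f(2) by blast
      then have "inj_on (f(a := b)) (insert a (A - {a}))"
        using f(1) by (auto simp: inj_on_def)
      then have "inj_on (f(a := b)) A" using a by (simp add: insert_absorb)
      moreover have "\<forall>x\<in>A. (f(a := b)) x \<in> N x" using f b by auto
      ultimately show ?thesis by blast
    qed simp
  qed
qed

text \<open>A tiling pairs each downward unit triangle with one of its upward neighbours.\<close>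

lemma tileable_iff_matching:
  "tileable T \<longleftrightarrow> (\<exists>f. bij_betw f {n. Down n \<in> T} {m. Up m \<in> T} \<and>
    (\<forall>n. Down n \<in> T \<longrightarrow> (\<exists>v. f n = n + var_mono v)))"
proof
  assume "tileable T"
  then have "T = {} \<or> (\<exists>P. partition_on T P \<and> (\<forall>L\<in>P. lozenge L))"
    by (simp only: tileable_def)
  then show "\<exists>f. bij_betw f {n. Down n \<in> T} {m. Up m \<in> T} \<and>
    (\<forall>n. Down n \<in> T \<longrightarrow> (\<exists>v. f n = n + var_mono v))"
  proof (elim disjE exE conjE)
    fix P assume 2: "partition_on T P" "\<forall>L\<in>P. lozenge L"
    have eq: "L = L'" if "L \<in> P" "L' \<in> P" "x \<in> L" "x \<in> L'" for L L' x
      using that partition_onD2[OF 2(1)] by (auto simp: disjoint_def)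
    have PT: "\<Union>P = T" using partition_onD1[OF 2(1)] by simp
    have "\<exists>m. {Down n, Up m} \<in> P \<and> (\<exists>v. m = n + var_mono v)" if "Down n \<in> T" for n
      using that PT 2(2) by (force simp: lozenge_def)
    then obtain f where f: "\<And>n. Down n \<in> T \<Longrightarrow> {Down n, Up (f n)} \<in> P"
      "\<And>n. Down n \<in> T \<Longrightarrow> \<exists>v. f n = n + var_mono v" by metis
    have "bij_betw f {n. Down n \<in> T} {m. Up m \<in> T}"
    proof (intro bij_betw_imageI inj_onI equalityI subsetI)
      fix n n' assume "n \<in> {n. Down n \<in> T}" "n' \<in> {n. Down n \<in> T}" "f n = f n'"
      then have "{Down n, Up (f n)} = {Down n', Up (f n')}"
        by (intro eq[of _ _ "Up (f n)"] f) auto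
      then show "n = n'" by (simp add: doubleton_eq_iff)
    next
      fix m assume "m \<in> f ` {n. Down n \<in> T}"
      then show "m \<in> {m. Up m \<in> T}" using f(1) PT by auto
    next
      fix m assume "m \<in> {m. Up m \<in> T}"
      then obtain L where L: "L \<in> P" "Up m \<in> L" using PT by auto
      then obtain n where n: "L = {Down n, Up m}" using 2(2) by (auto simp: lozenge_def)
      then have nT: "Down n \<in> T" using L PT by auto
      have "{Down n, Up (f n)} = L" using n f(1)[OF nT] L by (intro eq[of _ _ "Down n"]) auto
      then have "f n = m" using n by (simp add: doubleton_eq_iff)
      then show "m \<in> f ` {n. Down n \<in> T}" using nT by auto
    qed
    with f(2) show ?thesis by blast
  qed (simp add: bij_betw_def)
next
  assume "\<exists>f. bij_betw f {n. Down n \<in> T} {m. Up m \<in> T} \<and>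
    (\<forall>n. Down n \<in> T \<longrightarrow> (\<exists>v. f n = n + var_mono v))"
  then obtain f where f: "bij_betw f {n. Down n \<in> T} {m. Up m \<in> T}"
    "\<And>n. Down n \<in> T \<Longrightarrow> \<exists>v. f n = n + var_mono v" by blast
  let ?P = "(\<lambda>n. {Down n, Up (f n)}) ` {n. Down n \<in> T}"
  have inj: "n = n'" if "Down n \<in> T" "Down n' \<in> T" "f n = f n'" for n n'
    using that f(1) by (auto simp: bij_betw_def inj_on_def)
  have im: "f ` {n. Down n \<in> T} = {m. Up m \<in> T}" using f(1) by (simp add: bij_betw_def)
  have "partition_on T ?P"
  proof (intro partition_onI)
    show "\<Union>?P = T"
    proof (intro equalityI subsetI)
      fix t assume "t \<in> T"
      then show "t \<in> \<Union>?P"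
      proof (cases t)
        case (Up m)
        with \<open>t \<in> T\<close> have "m \<in> f ` {n. Down n \<in> T}" using im by simp
        with Up show ?thesis by auto
      qed auto
    qed (use im in auto)
  next
    fix L L' assume "L \<in> ?P" "L' \<in> ?P" "L \<noteq> L'"
    then show "disjnt L L'" using inj by (auto simp: disjnt_def)
  qed auto
  moreover have "\<forall>L\<in>?P. lozenge L" using f(2) by (force simp: lozenge_def)
  ultimately show "tileable T" unfolding tileable_def by blast
qed

definition region :: "nat \<Rightarrow> mono set \<Rightarrow> unit_triangle set" where
  "region d X = Up ` level d 1 (- X) \<union> Down ` level d 2 (- X)"

lemma Up_Down_in_region [simp]:
  "{m. Up m \<in> region d X} = level d 1 (- X)" "{n. Down n \<in> region d X} = level d 2 (- X)"
  "Down n \<in> region d X \<longleftrightarrow> n \<in> level d 2 (- X)"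
  by (auto simp: region_def)

lemma excess_UNIV: "excess d UNIV = int d"
proof -
  have "multiples {0} = UNIV" by (auto simp: multiples_def mono_dvd_iff)
  then show ?thesis using excess_multiples_singleton[of d 0] by simp
qed

lemma excess_split: "excess d Y = excess d (Y - X) + excess d (X \<inter> Y)"
proof -
  have "(Y - X) \<union> (X \<inter> Y) = Y" by blast
  then show ?thesis using excess_Un_disjoint[of "Y - X" "X \<inter> Y" d] by auto
qed

lemma excess_Compl: "excess d (- X) = int d - excess d X"
  using excess_split[of d UNIV X] by (simp add: excess_UNIV Compl_eq_Diff_UNIV)

lemma tileable_imp_balanced:
  assumes "tileable (region d X)"
  shows "excess d X = int d"
proof -
  have "card (level d 2 (- X)) = card (level d 1 (- X))"
    using assms by (auto simp: tileable_iff_matching intro: bij_betw_same_card)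
  then show ?thesis using excess_Compl[of d X] by (simp add: excess_def)
qed

text \<open>
  A lozenge whose downward triangle lies in a set \<open>Y\<close> closed under multiples lies in \<open>Y\<close>
  altogether, so the tiling matches the downward triangles of \<open>Y - X\<close> within \<open>Y - X\<close>.
\<close>

lemma tileable_imp_excess_Int_le:
  assumes "tileable (region d X)" "mult_closed Y"
  shows "excess d (X \<inter> Y) \<le> excess d Y"
proof -
  obtain f where f: "bij_betw f (level d 2 (- X)) (level d 1 (- X))"
    "\<And>n. n \<in> level d 2 (- X) \<Longrightarrow> \<exists>v. f n = n + var_mono v"
    using assms(1) by (auto simp: tileable_iff_matching)
  have "f n \<in> level d 1 (Y - X)" if n: "n \<in> level d 2 (Y - X)" for n
  proof -
    have nX: "n \<in> level d 2 (- X)" "n \<in> Y" using n by (auto simp: level_def)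
    then have "f n \<in> level d 1 (- X)" using f(1) by (auto simp: bij_betw_def)
    moreover have "f n \<in> Y" using f(2)[OF nX(1)] nX(2) assms(2) by (auto intro: mult_closedD)
    ultimately show ?thesis by (auto simp: level_def)
  qed
  moreover have "inj_on f (level d 2 (Y - X))"
    using f(1) by (auto simp: bij_betw_def level_def intro: inj_on_subset)
  ultimately have "card (level d 2 (Y - X)) \<le> card (level d 1 (Y - X))"
    by (intro card_inj_on_le[of f]) auto
  then show ?thesis using excess_split[of d Y X] by (simp add: excess_def)
qed

text \<open>
  Hall's condition in terms of the excess: adding the multiples of a set \<open>D\<close> of downward triangles
  to \<open>X\<close> changes the excess by the number of upward neighbours of \<open>D\<close> minus the size of \<open>D\<close>.
\<close>

lemma tileableI_excess:
  assumes X: "excess d X = int d"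
    and heavy: "\<And>D. D \<subseteq> level d 2 (- X) \<Longrightarrow> int d \<le> excess d (X \<union> multiples D)"
  shows "tileable (region d X)"
proof -
  let ?A = "level d 2 (- X)" and ?B = "level d 1 (- X)"
  let ?N = "\<lambda>n. level d 1 (multiples {n} - X)"
  have "card D \<le> card (\<Union>(?N ` D))" if D: "D \<subseteq> ?A" for D
  proof -
    have "\<Union>(?N ` D) = level d 1 (multiples D - X)"
      by (auto simp: level_def multiples_def)
    moreover have "level d 2 (multiples D - X) = D"
    proof (intro equalityI subsetI)
      fix m assume "m \<in> level d 2 (multiples D - X)"
      then obtain n where "n \<in> D" "mono_dvd n m" "mdeg m + 2 = d" by (auto simp: level_def multiples_def)
      with D mono_dvd_mdeg[of n m] show "m \<in> D" by (cases "n = m") (auto simp: level_def)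
    qed (use D in \<open>auto simp: level_def multiples_def intro: mono_dvd_refl\<close>)
    moreover have "excess d (X \<union> multiples D) = excess d X + excess d (multiples D - X)"
      using excess_Un_disjoint[of X "multiples D - X" d] by simp
    ultimately show ?thesis using heavy[OF D] X by (simp add: excess_def)
  qed
  then obtain f where f: "inj_on f ?A" "\<forall>n\<in>?A. f n \<in> ?N n"
    using hall_marriage[of ?A ?N] by auto
  have "card ?A = card ?B" using X excess_Compl[of d X] by (simp add: excess_def)
  moreover have "f ` ?A \<subseteq> ?B" using f(2) by (auto simp: level_def)
  ultimately have "f ` ?A = ?B" using f(1) by (simp add: card_image card_subset_eq)
  moreover have "\<exists>v. f n = n + var_mono v" if n: "n \<in> ?A" for n
  proof -
    have "mono_dvd n (f n)" "mdeg (f n) = mdeg n + 1" using n f(2) by (auto simp: level_def multiples_def)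
    then obtain k where k: "f n = n + k" "mdeg k = 1" by (auto simp: mono_dvd_def)
    with mdeg_1_cases[OF k(2)] show ?thesis by metis
  qed
  ultimately show ?thesis using f(1) unfolding tileable_iff_matching by (auto simp: bij_betw_def)
qed


section \<open>Slopes and loads\<close>

text \<open>
  If all \<open>d\<close> rows are nonempty, an excess of \<open>d\<close> means that each row is entered exactly once, that
  is, has no gap. A boundary row contains two corners and hence is full. Then every row, in each
  direction, contains both its ends and is full as well.
\<close>

lemma gapless_rows_fill:
  assumes X: "mult_closed X" and bal: "excess d X = int d"
    and corner: "\<And>v. Poly_Mapping.single v (d - 1) \<in> X"
    and rows: "\<And>v i. i < d \<Longrightarrow> \<exists>a\<in>level d 1 X. expo a v = i"
    and c: "mdeg c + 1 = d"
  shows "c \<in> X"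
proof -
  have gap: "m \<in> X"
    if "v \<noteq> w" "a \<in> X" "b \<in> X" "mdeg a + 1 = d" "mdeg b + 1 = d" "mdeg m + 1 = d"
      "expo a v = expo m v" "expo b v = expo m v" "expo a w < expo m w" "expo m w < expo b w"
    for v w a b m
  proof (rule ccontr)
    assume "m \<notin> X"
    have "int (card {..<d}) < excess d X"
      by (rule excess_gt_rows[OF X _ \<open>v \<noteq> w\<close>, of "{..<d}" d a b m])
        (use that \<open>m \<notin> X\<close> rows in \<open>auto simp: level_def\<close>)
    with bal show False by simp
  qed
  \<comment> \<open>the boundary row of exponent 0 in \<open>v\<close> joins the corners in the directions \<open>w\<close> and \<open>t\<close>\<close>
  have edge: "m \<in> X" if m: "mdeg m + 1 = d" "expo m v = 0" for m v
  proof -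
    obtain w t where vwt: "distinct [v, w, t]" using two_other_variables[of v] .
    let ?a = "Poly_Mapping.single t (d - 1)" and ?b = "Poly_Mapping.single w (d - 1)"
    have deg: "expo m w + expo m t + 1 = d" using mdeg_three[OF vwt, of m] m by simp
    show ?thesis
    proof (cases "expo m w = 0 \<or> expo m t = 0")
      case True
      have eq: "m = ?a" if "expo m w = 0"
        using vwt m deg that
        by (intro mono_eqI_two_exponents[of v w]) (auto simp: lookup_single when_def)
      have "m = ?b" if "expo m t = 0"
        using vwt m deg that
        by (intro mono_eqI_two_exponents[of v t]) (auto simp: lookup_single when_def)
      with eq True corner show ?thesis by metis
    next
      case False
      show ?thesis
        by (rule gap[of v w ?a ?b m])
          (use vwt m deg False corner in \<open>auto simp: lookup_single when_def\<close>)
    qed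
  qed
  show ?thesis
  proof (cases "expo c Vy = 0 \<or> expo c Vz = 0")
    case False
    \<comment> \<open>the two ends of the row of \<open>c\<close> lie on the boundary\<close>
    let ?x = "Poly_Mapping.single Vx (expo c Vx)" and ?k = "expo c Vy + expo c Vz"
    let ?a = "?x + Poly_Mapping.single Vz ?k" and ?b = "?x + Poly_Mapping.single Vy ?k"
    have deg: "expo c Vx + expo c Vy + expo c Vz + 1 = d"
      using mdeg_three[of Vx Vy Vz c] c by simp
    have "?a \<in> X"
      by (rule edge[of _ Vy]) (use deg in \<open>auto simp: lookup_add lookup_single when_def\<close>)
    moreover have "?b \<in> X"
      by (rule edge[of _ Vz]) (use deg in \<open>auto simp: lookup_add lookup_single when_def\<close>)
    ultimately show ?thesis
      by (rule gap[of Vx Vy ?a ?b c, rotated])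
        (use deg c False in \<open>auto simp: lookup_add lookup_single when_def\<close>)
  qed (use c edge in blast)
qed

text \<open>
  The combinatorial properties of the minimal generators of an Artinian monomial ideal. The pure
  powers puncture the corners of the big triangle.
\<close>

locale puncturing =
  fixes d :: nat and G :: "mono set"
  assumes finite_G: "finite G"
    and degree_le: "\<And>g. g \<in> G \<Longrightarrow> mdeg g \<le> d"
    and pure_power: "\<And>v. \<exists>a. Poly_Mapping.single v a \<in> G"
    and non_unit: "0 \<notin> G"
begin

definition load :: "mono set \<Rightarrow> int" where
  "load J = (\<Sum>g\<in>J. int (d - mdeg g))"

definition over :: int where
  "over = load G - int d"

definition slope :: real where
  "slope = real_of_int over / (real (card G) - 1)"

text \<open>
  Brenner's criterion with both slopes increased by \<open>d\<close>. The left-hand side of each inequality is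
  then the over-puncturing coefficient of the hull of \<open>J\<close> by the generators in \<open>J\<close>.
\<close>

definition semistable :: bool where
  "semistable \<longleftrightarrow> (\<forall>J. J \<subset> G \<and> 2 \<le> card J \<longrightarrow>
     real_of_int (load J - int (d - mdeg (mono_gcd J))) \<le> (real (card J) - 1) * slope)"

lemma finite_subset_G: "J \<subseteq> G \<Longrightarrow> finite J"
  using finite_G finite_subset by blast

lemma card_G: "2 \<le> card G"
proof -
  obtain a b where ab: "Poly_Mapping.single Vx a \<in> G" "Poly_Mapping.single Vy b \<in> G"
    using pure_power by blast
  have "Poly_Mapping.single Vx a \<noteq> Poly_Mapping.single Vy b"
  proof
    assume eq: "Poly_Mapping.single Vx a = Poly_Mapping.single Vy b"
    have "expo (Poly_Mapping.single Vx a) Vx = expo (Poly_Mapping.single Vy b) Vx" by (simp only: eq)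
    then have "a = 0" by (simp add: lookup_single when_def)
    with ab(1) non_unit show False by simp
  qed
  then have "card {Poly_Mapping.single Vx a, Poly_Mapping.single Vy b} = 2" by simp
  with card_mono[OF finite_G, of "{Poly_Mapping.single Vx a, Poly_Mapping.single Vy b}"] ab
  show ?thesis by simp
qed

text \<open>Pure powers of two different variables have no common divisor.\<close>

lemma dvd_all_imp_unit:
  assumes "\<And>g. g \<in> G \<Longrightarrow> mono_dvd h g"
  shows "h = 0"
proof (rule poly_mapping_eqI)
  fix v :: var
  obtain w t where "distinct [v, w, t]" using two_other_variables[of v] .
  moreover obtain a where "Poly_Mapping.single w a \<in> G" using pure_power by blast
  ultimately have "expo h v \<le> 0"
    using assms[of "Poly_Mapping.single w a"] by (auto simp: mono_dvd_iff lookup_single when_def dest: spec[of _ v])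
  then show "expo h v = expo 0 v" by simp
qed

lemma dvd_gcd: "J \<subseteq> G \<Longrightarrow> J \<noteq> {} \<Longrightarrow> mono_dvd k (mono_gcd J) \<longleftrightarrow> (\<forall>g\<in>J. mono_dvd k g)"
  using mono_gcd_is_gcd finite_subset_G by blast

text \<open>
  With slope 0, no triangle contains punctures of total side length larger than its own. For the
  big triangle this is \<open>over = 0\<close>; otherwise semistability gives the bound for the hull of the
  punctures in the triangle.
\<close>

lemma load_over_hull_le:
  assumes "semistable" "over = 0"
  shows "load {g \<in> G. mono_dvd h g} \<le> int (d - mdeg h)"
proof -
  let ?J = "{g \<in> G. mono_dvd h g}"
  consider "?J = G" | "?J \<subset> G" "2 \<le> card ?J" | "card ?J = 0" | "card ?J = 1" by fastforce
  then show ?thesis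
  proof cases
    case 1
    then have "h = 0" by (intro dvd_all_imp_unit) blast
    with 1 assms(2) show ?thesis by (simp add: over_def)
  next
    case 2
    then have "real_of_int (load ?J - int (d - mdeg (mono_gcd ?J))) \<le> 0"
      using assms by (auto simp: semistable_def slope_def)
    moreover have "?J \<noteq> {}" using 2(2) by (metis card.empty not_numeral_le_zero)
    then have "mono_dvd h (mono_gcd ?J)" by (subst dvd_gcd) auto
    then have "mdeg h \<le> mdeg (mono_gcd ?J)" by (rule mdeg_le)
    ultimately show ?thesis by linarith
  next
    case 3
    moreover have "finite ?J" by (rule finite_subset_G) blast
    ultimately have empty: "?J = {}" by (simp only: card_0_eq)
    show ?thesis unfolding load_def empty by simp
  next
    case 4
    then obtain g where g: "?J = {g}" by (auto simp: card_1_singleton_iff)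
    then have "mdeg h \<le> mdeg g" by (intro mdeg_le) blast
    then show ?thesis unfolding load_def g by simp
  qed
qed

lemma load_le_cover:
  assumes "finite H" "F \<subseteq> G" and cover: "\<And>g. g \<in> F \<Longrightarrow> \<exists>h\<in>H. mono_dvd h g"
  shows "load F \<le> (\<Sum>h\<in>H. load {g \<in> F. mono_dvd h g})"
proof -
  have fin: "finite F" using assms(2) finite_subset_G by blast
  have "load F \<le> (\<Sum>g\<in>F. \<Sum>h\<in>H. if mono_dvd h g then int (d - mdeg g) else 0)"
    unfolding load_def
  proof (rule sum_mono)
    fix g assume "g \<in> F"
    then obtain h where "h \<in> H" "mono_dvd h g" using cover by blast
    then show "int (d - mdeg g) \<le> (\<Sum>h\<in>H. if mono_dvd h g then int (d - mdeg g) else 0)"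
      using member_le_sum[of h H "\<lambda>h. if mono_dvd h g then int (d - mdeg g) else 0"] assms(1) by simp
  qed
  also have "\<dots> = (\<Sum>h\<in>H. load {g \<in> F. mono_dvd h g})"
    unfolding load_def by (subst sum.swap) (simp add: sum.inter_filter fin)
  finally show ?thesis .
qed

text \<open>
  For Hall's condition, merge the punctures together with the triangles of side length 2 given by
  the downward unit triangles in \<open>D\<close>. By the preceding bound the side lengths of the merged
  triangles add up to at least those of the punctures in them, hence to at least \<open>d\<close>.
\<close>

lemma semistable_imp_tileable:
  assumes "semistable" "over = 0"
  shows "tileable (region d (multiples G))"
proof -
  have heavy: "int d \<le> excess d (multiples G \<union> multiples D)" if D: "finite D" for D
  proof -
    have "finite (G \<union> D)" using finite_G D by simp
    then obtain H where H: "finite H" "\<And>g. g \<in> G \<union> D \<Longrightarrow> \<exists>h\<in>H. mono_dvd h g"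
      "(\<Sum>h\<in>H. int (d - mdeg h)) \<le> excess d (multiples (G \<union> D))"
      by (rule merge_overlapping[where d = d]) blast
    have "int d = load G" using assms(2) by (simp add: over_def)
    also have "\<dots> \<le> (\<Sum>h\<in>H. load {g \<in> G. mono_dvd h g})"
      using H by (intro load_le_cover) auto
    also have "\<dots> \<le> (\<Sum>h\<in>H. int (d - mdeg h))"
      by (intro sum_mono load_over_hull_le assms)
    finally show ?thesis using H(3) by (simp add: multiples_Un)
  qed
  show ?thesis
  proof (rule tileableI_excess)
    have "excess d (multiples G) \<le> int d"
      using excess_multiples_le[OF finite_G, of d] assms(2) by (simp add: over_def load_def)
    then show "excess d (multiples G) = int d"
      using heavy[of "{}"] by (simp add: multiples_def)
  qed (use heavy finite_subset[OF _ finite_level] in blast)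
qed

text \<open>
  The union of the punctures has excess \<open>d\<close>, which is the sum of their side lengths, so they do
  not overlap. In the hull of \<open>J\<close> the punctures in \<open>J\<close> then contribute their full load to an excess
  that the tiling bounds by the side length of the hull.
\<close>

lemma tileable_imp_semistable:
  assumes "tileable (region d (multiples G))" "over = 0"
  shows "semistable"
  unfolding semistable_def
proof (intro allI impI, elim conjE)
  fix J assume J: "J \<subset> G" "2 \<le> card J"
  let ?m = "mono_gcd J" and ?Y = "multiples (G - J)"
  have no: "\<not> overlap d g h" if "g \<in> G" "h \<in> G" "g \<noteq> h" for g h
    using excess_multiples_less[OF finite_G that, of d] tileable_imp_balanced[OF assms(1)] assms(2)
    by (auto simp: over_def load_def)
  have ne: "J \<noteq> {}" using J(2) by (metis card.empty not_numeral_le_zero)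
  have dvd: "mono_dvd ?m g" if "g \<in> J" for g
    using dvd_gcd[of J ?m] J(1) ne that by auto
  have "load J = excess d (multiples J)"
    unfolding load_def using J(1) no finite_subset_G[of J] by (intro excess_multiples_eq[symmetric]) auto
  also have "\<dots> \<le> excess d (multiples J) + excess d (?Y \<inter> multiples {?m})"
    using excess_nonneg[of "?Y \<inter> multiples {?m}" d] by (simp add: mult_closed_Int)
  also have "\<dots> = excess d (multiples J \<union> (?Y \<inter> multiples {?m}))"
  proof (rule excess_Un_disjoint[symmetric])
    fix n assume "n \<in> multiples J" "n \<in> ?Y \<inter> multiples {?m}"
    then obtain g h where gh: "g \<in> J" "h \<in> G - J" "mono_dvd g n" "mono_dvd h n"
      by (auto simp: multiples_def)
    moreover have "\<not> overlap d g h" using gh(1,2) J(1) by (intro no) auto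
    ultimately show "d \<le> mdeg n" by (meson not_le overlap_def)
  qed
  also have "multiples J \<union> (?Y \<inter> multiples {?m}) = multiples G \<inter> multiples {?m}"
    using J(1) dvd by (auto simp: multiples_def intro: mono_dvd_trans)
  also have "excess d (multiples G \<inter> multiples {?m}) \<le> excess d (multiples {?m})"
    using assms(1) by (rule tileable_imp_excess_Int_le) simp
  finally show "real_of_int (load J - int (d - mdeg ?m)) \<le> (real (card J) - 1) * slope"
    using assms(2) by (simp add: excess_multiples_singleton slope_def)
qed

text \<open>
  The load that overlaps absorb. After merging, each merged triangle is the hull of the punctures
  in it, and semistability bounds what is lost there by \<open>slope\<close> times one less than the number of
  these punctures. Since merged triangles do not overlap, every puncture lies in only one of them.
\<close>

lemma load_minus_excess_le:
  assumes "semistable" "0 \<le> over" and F: "F \<subset> G" "F \<noteq> {}" "\<And>g. g \<in> F \<Longrightarrow> mdeg g < d"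
  shows "real_of_int (load F - excess d (multiples F)) \<le> (real (card F) - 1) * slope"
proof -
  have fin: "finite F" using F(1) finite_subset_G by blast
  obtain H where H: "finite H" "\<And>g. g \<in> F \<Longrightarrow> \<exists>h\<in>H. mono_dvd h g"
    "\<And>h. h \<in> H \<Longrightarrow> \<exists>g\<in>F. mono_dvd h g"
    "\<And>h k. h \<in> H \<Longrightarrow> (\<And>g. g \<in> F \<Longrightarrow> mono_dvd h g \<Longrightarrow> mono_dvd k g) \<Longrightarrow> mono_dvd k h"
    "\<And>h h'. h \<in> H \<Longrightarrow> h' \<in> H \<Longrightarrow> h \<noteq> h' \<Longrightarrow> \<not> overlap d h h'"
    "(\<Sum>h\<in>H. int (d - mdeg h)) \<le> excess d (multiples F)"
    using merge_overlapping[OF fin, of d] by blast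
  let ?J = "\<lambda>h. {g \<in> F. mono_dvd h g}"
  have "0 \<le> slope" using assms(2) card_G by (simp add: slope_def)
  have step: "real_of_int (load (?J h) - int (d - mdeg h)) \<le> (real (card (?J h)) - 1) * slope"
    if h: "h \<in> H" for h
  proof -
    have J: "?J h \<subset> G" "?J h \<noteq> {}" using F(1) H(3)[OF h] by auto
    have dvd: "mono_dvd k (mono_gcd (?J h)) \<longleftrightarrow> (\<forall>g\<in>?J h. mono_dvd k g)" for k
      using J by (intro dvd_gcd) auto
    have gcd: "mono_gcd (?J h) = h"
    proof (rule mono_dvd_antisym)
      show "mono_dvd (mono_gcd (?J h)) h"
        using dvd[of "mono_gcd (?J h)"] by (intro H(4)[OF h]) auto
    qed (use dvd in auto)
    have "0 < card (?J h)" using J fin by (simp add: card_gt_0_iff)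
    then consider "2 \<le> card (?J h)" | "card (?J h) = 1" by linarith
    then show ?thesis
    proof cases
      case 1
      with assms(1) J(1) gcd show ?thesis unfolding semistable_def by metis
    next
      case 2
      then obtain g where g: "?J h = {g}" by (auto simp: card_1_singleton_iff)
      with gcd have "h = g" by (auto simp: mono_gcd_def)
      with g show ?thesis by (simp add: load_def)
    qed
  qed
  have disj: "?J h \<inter> ?J h' = {}" if "h \<in> H" "h' \<in> H" "h \<noteq> h'" for h h'
    using H(5)[OF that] F(3) by (auto simp: overlap_def)
  have "F = (\<Union>h\<in>H. ?J h)" using H(2) by blast
  then have "card F = (\<Sum>h\<in>H. card (?J h))"
    using card_UN_disjoint[of H ?J] H(1) fin disj by simp
  have "H \<noteq> {}" using H(2) F(2) by blast
  then have "1 \<le> real (card H)" using H(1) by (simp add: Suc_leI card_gt_0_iff)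
  have "load F \<le> (\<Sum>h\<in>H. load (?J h))"
    using H(1,2) F(1) by (intro load_le_cover) auto
  then have "load F - excess d (multiples F) \<le> (\<Sum>h\<in>H. load (?J h) - int (d - mdeg h))"
    unfolding sum_subtractf using H(6) by linarith
  then have "real_of_int (load F - excess d (multiples F)) \<le> real_of_int (\<Sum>h\<in>H. load (?J h) - int (d - mdeg h))"
    by (simp only: of_int_le_iff)
  also have "\<dots> = (\<Sum>h\<in>H. real_of_int (load (?J h) - int (d - mdeg h)))"
    by (rule of_int_sum)
  also have "\<dots> \<le> (\<Sum>h\<in>H. (real (card (?J h)) - 1) * slope)"
    by (intro sum_mono step)
  also have "\<dots> = (real (card F) - real (card H)) * slope"
    using \<open>card F = _\<close> by (simp add: sum_subtractf flip: sum_distrib_right)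
  also have "\<dots> \<le> (real (card F) - 1) * slope"
    using \<open>0 \<le> slope\<close> \<open>1 \<le> real (card H)\<close> by (intro mult_right_mono) auto
  finally show ?thesis .
qed

text \<open>
  If \<open>over\<close> is positive, the overlaps absorb \<open>over\<close>, which is \<open>card G - 1\<close> times the slope. By the
  previous bound, less than this is absorbed if a generator of degree \<open>d\<close> is discarded, or if the
  punctures split into two families without overlaps between them, as they would at an empty row.
  So the punctures contain the corners and meet every row, and the balance fills the big triangle.
\<close>

lemma tileable_semistable_imp_over_eq_0:
  assumes tile: "tileable (region d (multiples G))" and semi: "semistable"
    and c: "mdeg c + 1 = d" "c \<notin> multiples G"
  shows "over = 0"
proof (rule ccontr)
  assume "over \<noteq> 0"
  let ?X = "multiples G" and ?F = "{g \<in> G. mdeg g < d}"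
  have bal: "excess d ?X = int d" using tile by (rule tileable_imp_balanced)
  then have "0 < over"
    using excess_multiples_le[OF finite_G, of d] \<open>over \<noteq> 0\<close> by (simp add: over_def load_def)
  then have pos: "0 < slope" using card_G by (simp add: slope_def)
  have over: "real_of_int over = (real (card G) - 1) * slope"
    using card_G by (simp add: slope_def)
  have bound: "real_of_int (load F - excess d (multiples F)) \<le> (real (card F) - 1) * slope"
    if "F \<subset> G" "F \<noteq> {}" "\<And>g. g \<in> F \<Longrightarrow> mdeg g < d" for F
    using load_minus_excess_le[OF semi _ that] \<open>0 < over\<close> by simp
  have "load ?F = load G"
    unfolding load_def using finite_G by (intro sum.mono_neutral_left) auto
  \<comment> \<open>without load, a generator of degree \<open>d\<close> would leave all of \<open>over\<close> to the other generators\<close>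
  have F: "?F = G"
  proof (rule ccontr)
    assume "?F \<noteq> G"
    then have sub: "?F \<subset> G" by blast
    have ex: "excess d (multiples ?F) = excess d ?X"
    proof (rule excess_cong)
      fix m assume "mdeg m < d"
      then show "m \<in> multiples ?F \<longleftrightarrow> m \<in> ?X"
        using mdeg_le le_less_trans by (fastforce simp: multiples_def)
    qed
    have "?F \<noteq> {}"
    proof
      assume "?F = {}"
      with \<open>load ?F = load G\<close> have "load G = 0" by (simp only: load_def sum.empty)
      with \<open>0 < over\<close> show False by (simp add: over_def)
    qed
    then have "real_of_int (load ?F - excess d (multiples ?F)) \<le> (real (card ?F) - 1) * slope"
      by (rule bound[OF sub]) blast
    then have "real_of_int over \<le> (real (card ?F) - 1) * slope"
      by (simp only: over_def ex bal \<open>load ?F = load G\<close>)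
    also have "\<dots> < (real (card G) - 1) * slope"
      using pos psubset_card_mono[OF finite_G sub] by (intro mult_strict_right_mono) auto
    finally show False using over by simp
  qed
  have rows: "\<exists>a\<in>level d 1 ?X. expo a v = i" if i: "i < d" for v i
  proof (rule ccontr)
    assume none: "\<not> (\<exists>a\<in>level d 1 ?X. expo a v = i)"
    define A where "A = {g \<in> G. i < expo g v}"
    define B where "B = {g \<in> G. expo g v \<le> i}"
    have AB: "A \<union> B = G" "A \<inter> B = {}" by (auto simp: A_def B_def)
    have fin: "finite A" "finite B" using finite_G by (auto simp: A_def B_def)
    have short: "d + expo g v \<le> i + mdeg g" if g: "g \<in> B" for g
    proof (rule ccontr)
      assume "\<not> ?thesis"
      then obtain u where "mono_dvd g u" "mdeg u + 1 = d" "expo u v = i"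
        using multiple_in_row[of g v i d] g by (auto simp: B_def)
      with none g show False by (auto simp: B_def level_def multiples_def)
    qed
    \<comment> \<open>the punctures in \<open>A\<close> lie above the empty row, those in \<open>B\<close> below it\<close>
    have "d \<le> mdeg m" if m: "m \<in> multiples A" "m \<in> multiples B" for m
    proof -
      obtain g h where g: "g \<in> A" "mono_dvd g m" and h: "h \<in> B" "mono_dvd h m"
        using m by (auto simp: multiples_def)
      then obtain k where k: "m = h + k" by (auto simp: mono_dvd_def)
      have "i < expo m v" using g by (auto simp: A_def mono_dvd_iff intro: less_le_trans)
      then show ?thesis using short[OF h(1)] expo_le_mdeg[of k v] by (simp add: k lookup_add)
    qed
    then have "excess d (multiples A \<union> multiples B) = excess d (multiples A) + excess d (multiples B)"
      by (rule excess_Un_disjoint)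
    then have ex: "int d = excess d (multiples A) + excess d (multiples B)"
      using bal by (simp only: multiples_Un[symmetric] AB(1))
    have ld: "load G = load A + load B"
      unfolding load_def using sum.union_disjoint[OF fin AB(2)] AB(1) by metis
    have cd: "card G = card A + card B"
      using card_Un_disjoint[OF fin AB(2)] AB(1) by simp
    obtain a where a: "Poly_Mapping.single v a \<in> G" using pure_power by blast
    have "\<not> a \<le> i"
    proof
      assume "a \<le> i"
      with a have "Poly_Mapping.single v a \<in> B" by (simp add: B_def)
      from short[OF this] i show False by simp
    qed
    with a have neA: "Poly_Mapping.single v a \<in> A" by (simp add: A_def)
    obtain w t where vwt: "distinct [v, w, t]" using two_other_variables[of v] .
    obtain b where "Poly_Mapping.single w b \<in> G" using pure_power by blast
    with vwt have neB: "Poly_Mapping.single w b \<in> B" by (auto simp: B_def lookup_single when_def)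
    have "real_of_int (load A - excess d (multiples A)) \<le> (real (card A) - 1) * slope"
      by (rule bound) (use neA neB AB F in blast)+
    moreover have "real_of_int (load B - excess d (multiples B)) \<le> (real (card B) - 1) * slope"
      by (rule bound) (use neA neB AB F in blast)+
    ultimately have "real_of_int over \<le> (real (card G) - 2) * slope"
      using ex ld cd by (simp add: over_def algebra_simps)
    with over pos show False by (simp add: algebra_simps)
  qed
  have corner: "Poly_Mapping.single v (d - 1) \<in> ?X" for v
  proof -
    obtain a where a: "Poly_Mapping.single v a \<in> G" using pure_power by blast
    with F have "mdeg (Poly_Mapping.single v a) < d" by blast
    then have "mono_dvd (Poly_Mapping.single v a) (Poly_Mapping.single v (d - 1))"
      by (auto simp: mono_dvd_iff lookup_single when_def)
    with a show ?thesis by (auto simp: multiples_def)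
  qed
  have "c \<in> ?X" by (rule gapless_rows_fill[OF _ bal corner rows c(1)]) simp_all
  with c(2) show False by simp
qed

end


section \<open>From ideals to puncturings\<close>

lemma to_poly_generator: "s \<in> S \<Longrightarrow> (to_poly s :: 'k::comm_ring_1 mpoly3) \<in> monomial_ideal S"
  unfolding to_poly_in_monomial_ideal_iff by (rule bexI[of _ s]) simp_all

text \<open>
  The chain of ideals generated by \<open>S\<close> and a growing power of one variable becomes stationary, at
  \<open>N\<close> say. The power with exponent \<open>N\<close> is then a multiple of an element of \<open>S\<close>, since it is not a
  multiple of the next power.
\<close>

lemma artinian_pure_power:
  assumes "artinian_ideal (monomial_ideal S :: 'k::comm_ring_1 mpoly3 set)"
  shows "\<exists>N. \<exists>s\<in>S. mono_dvd s (Poly_Mapping.single v N)"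
proof -
  let ?p = "Poly_Mapping.single v :: nat \<Rightarrow> mono"
  let ?A = "\<lambda>n. monomial_ideal (insert (?p n) S) :: 'k mpoly3 set"
  have "is_ideal (?A n)" for n
    unfolding is_ideal_def monomial_ideal_def ideal_of_def by (rule module.subspace_span[OF module_times])
  moreover have "monomial_ideal S \<subseteq> ?A n" for n
    by (rule monomial_ideal_mono) (auto intro: to_poly_generator)
  moreover have "?A (Suc n) \<subseteq> ?A n" for n
  proof (rule monomial_ideal_mono)
    have "mono_dvd (?p n) (?p (Suc n))" by (auto simp: mono_dvd_iff lookup_single when_def)
    then show "to_poly ` insert (?p (Suc n)) S \<subseteq> ?A n"
      by (auto simp: to_poly_in_monomial_ideal_iff intro: mono_dvd_refl to_poly_generator)
  qed
  ultimately have "\<forall>n. is_ideal (?A n) \<and> monomial_ideal S \<subseteq> ?A n \<and> ?A (Suc n) \<subseteq> ?A n" by simp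
  then have "\<exists>N. \<forall>n\<ge>N. ?A n = ?A N"
    by (rule assms[unfolded artinian_ideal_def, THEN conjunct2, THEN spec, of ?A, THEN mp])
  then obtain N where "\<forall>n\<ge>N. ?A n = ?A N" ..
  then have "?A (Suc N) = ?A N" by (rule allE[of _ "Suc N"]) simp
  moreover have "to_poly (?p N) \<in> ?A N" by (rule to_poly_generator) simp
  ultimately have "to_poly (?p N) \<in> ?A (Suc N)" by blast
  then obtain s where s: "s \<in> insert (?p (Suc N)) S" "mono_dvd s (?p N)"
    unfolding to_poly_in_monomial_ideal_iff by blast
  have "\<not> mono_dvd (?p (Suc N)) (?p N)" by (auto dest: mdeg_le)
  with s show ?thesis by auto
qed

lemma dvd_single: "mono_dvd g (Poly_Mapping.single v N) \<Longrightarrow> g = Poly_Mapping.single v (expo g v)"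
proof (rule poly_mapping_eqI)
  fix w
  assume "mono_dvd g (Poly_Mapping.single v N)"
  then have "expo g w \<le> expo (Poly_Mapping.single v N) w" unfolding mono_dvd_iff ..
  then show "expo g w = expo (Poly_Mapping.single v (expo g v)) w"
    by (cases "v = w") (simp_all add: lookup_single when_def)
qed

lemma divide_le_diff_iff:
  fixes c e s y :: real
  assumes "0 < c"
  shows "y / c \<le> s - e \<longleftrightarrow> y + c * e \<le> c * s"
proof -
  have "y / c \<le> s - e \<longleftrightarrow> y \<le> (s - e) * c" by (rule pos_divide_le_eq[OF assms])
  also have "\<dots> \<longleftrightarrow> y + c * e \<le> c * s" by (simp add: algebra_simps)
  finally show ?thesis .
qed

theorem theorem3p3:
  fixes I :: "'k::field_char_0 mpoly3 set" and d :: nat and S :: "mono set"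
  assumes "1 \<le> d"
    and "I = monomial_ideal S" and "\<forall>g\<in>S. mdeg g \<le> d"
    and "artinian_ideal I"
    and "triangular_region d I \<noteq> {}"
  shows "(overpuncturing d I = 0 \<and> tileable (triangular_region d I) \<longrightarrow> syzygy_bundle_semistable I)
    \<and> (overpuncturing d I = 0 \<and> syzygy_bundle_semistable I \<longrightarrow> tileable (triangular_region d I))
    \<and> (tileable (triangular_region d I) \<and> syzygy_bundle_semistable I \<longrightarrow> overpuncturing d I = 0)"
proof -
  define G where "G = mingens I"
  have G: "g \<in> G \<longleftrightarrow> to_poly g \<in> I \<and> (\<forall>h. to_poly h \<in> I \<and> mono_dvd h g \<longrightarrow> h = g)" for g
    unfolding G_def mingens_eq[OF assms(2)] by simp
  have "minimally_generates G I"
    unfolding minimally_generates_iff[OF assms(2)] using G by blast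
  then have "I = monomial_ideal G" by (simp add: minimally_generates_def)
  then have in_I: "to_poly m \<in> I \<longleftrightarrow> m \<in> multiples G" for m
    by (simp add: to_poly_in_monomial_ideal_iff multiples_def)
  have "G \<subseteq> S"
  proof
    fix g assume g: "g \<in> G"
    then obtain s where s: "s \<in> S" "mono_dvd s g"
      using G unfolding assms(2) to_poly_in_monomial_ideal_iff by blast
    then have "to_poly s \<in> I" unfolding assms(2) by (intro to_poly_generator)
    with s G g show "g \<in> S" by metis
  qed
  then have deg: "mdeg g \<le> d" if "g \<in> G" for g using assms(3) that by blast
  have region: "triangular_region d I = region d (multiples G)"
    by (auto simp: triangular_region_def triangle_def region_def level_def in_I)
  interpret puncturing d G
  proof
    show "finite G" by (rule finite_subset[OF _ finite_mdeg_le[of d]]) (use deg in blast)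
    show "\<exists>a. Poly_Mapping.single v a \<in> G" for v
    proof -
      obtain N s where "s \<in> S" "mono_dvd s (Poly_Mapping.single v N)"
        using artinian_pure_power[OF assms(4)[unfolded assms(2)]] by blast
      then have "Poly_Mapping.single v N \<in> multiples G"
        unfolding in_I[symmetric] assms(2) to_poly_in_monomial_ideal_iff by blast
      then obtain g where "g \<in> G" "mono_dvd g (Poly_Mapping.single v N)"
        by (auto simp: multiples_def)
      then show ?thesis using dvd_single by metis
    qed
    show "0 \<notin> G"
    proof
      assume "0 \<in> G"
      moreover have "mono_dvd 0 m" for m by (simp add: mono_dvd_iff)
      ultimately have "m \<in> multiples G" for m unfolding multiples_def by blast
      then have "region d (multiples G) = {}" by (simp add: region_def level_def)
      with region assms(5) show False by simp
    qed
  qed (rule deg)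
  have "(\<Sum>g | g \<in> G \<and> mdeg g < d. int d - int (mdeg g)) = (\<Sum>g\<in>G. int (d - mdeg g))"
    by (rule sum.mono_neutral_cong_left[OF finite_G]) auto
  then have over: "overpuncturing d I = over"
    unfolding overpuncturing_def over_def load_def G_def[symmetric] by (rule arg_cong)
  have load_real: "real_of_int (load J) = real (card J) * d - (\<Sum>g\<in>J. real (mdeg g))" if "J \<subseteq> G" for J
  proof -
    have "real_of_int (load J) = (\<Sum>g\<in>J. real d - real (mdeg g))"
      unfolding load_def of_int_sum
    proof (rule sum.cong[OF refl])
      fix g assume "g \<in> J"
      with that have "mdeg g \<le> d" by (intro deg) blast
      then show "real_of_int (int (d - mdeg g)) = real d - real (mdeg g)" by (simp add: of_nat_diff)
    qed
    then show ?thesis by (simp add: sum_subtractf)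
  qed
  have pos: "0 < real (card G) - 1" using card_G by simp
  \<comment> \<open>both slopes in Brenner's criterion are shifted by \<open>d\<close>\<close>
  have slope: "- (\<Sum>g\<in>G. real (mdeg g)) / (real (card G) - 1) = slope - d"
  proof -
    have "real_of_int over = (real (card G) - 1) * d - (\<Sum>g\<in>G. real (mdeg g))"
      unfolding over_def of_int_diff load_real[OF subset_refl] by (simp add: algebra_simps)
    then show ?thesis using pos by (simp add: slope_def diff_divide_distrib)
  qed
  have "(real (mdeg (mono_gcd J)) - (\<Sum>g\<in>J. real (mdeg g))) / (real (card J) - 1) \<le> slope - d \<longleftrightarrow>
    real_of_int (load J - int (d - mdeg (mono_gcd J))) \<le> (real (card J) - 1) * slope"
    if J: "J \<subset> G" "2 \<le> card J" for J
  proof -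
    have "J \<noteq> {}" using J(2) by (metis card.empty not_numeral_le_zero)
    then obtain g where "g \<in> J" by blast
    then have "mono_dvd (mono_gcd J) g" using dvd_gcd[of J "mono_gcd J"] J(1) \<open>J \<noteq> {}\<close> by auto
    then have "mdeg (mono_gcd J) \<le> mdeg g" by (rule mdeg_le)
    also have "mdeg g \<le> d" using J(1) \<open>g \<in> J\<close> by (intro deg) blast
    finally have "mdeg (mono_gcd J) \<le> d" .
    then have "real_of_int (load J - int (d - mdeg (mono_gcd J)))
      = (real (mdeg (mono_gcd J)) - (\<Sum>g\<in>J. real (mdeg g))) + (real (card J) - 1) * d"
      unfolding of_int_diff load_real[OF psubset_imp_subset[OF J(1)]] by (simp add: of_nat_diff ring_distribs)
    moreover have "0 < real (card J) - 1" using J(2) by simp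
    ultimately show ?thesis by (simp only: divide_le_diff_iff)
  qed
  then have semi: "syzygy_bundle_semistable I \<longleftrightarrow> semistable"
    unfolding syzygy_bundle_semistable_def semistable_def G_def[symmetric] slope by blast
  have over_0: "over = 0" if tile: "tileable (region d (multiples G))" and "semistable"
  proof -
    obtain f where f: "bij_betw f (level d 2 (- multiples G)) (level d 1 (- multiples G))"
      using tile by (auto simp: tileable_iff_matching)
    \<comment> \<open>every lozenge of a tiling contains an upward unit triangle\<close>
    have "level d 1 (- multiples G) \<noteq> {}"
    proof
      assume "level d 1 (- multiples G) = {}"
      with f have "level d 2 (- multiples G) = {}" by (auto simp: bij_betw_def)
      with \<open>level d 1 (- multiples G) = {}\<close> region assms(5) show False by (simp add: region_def)
    qed
    then obtain c where "mdeg c + 1 = d" "c \<notin> multiples G" by (auto simp: level_def)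
    with tile \<open>semistable\<close> show ?thesis by (rule tileable_semistable_imp_over_eq_0)
  qed
  show ?thesis
    unfolding region over semi
  proof (intro conjI impI)
    assume "over = 0 \<and> tileable (region d (multiples G))"
    then show "semistable" using tileable_imp_semistable by simp
  next
    assume "over = 0 \<and> semistable"
    then show "tileable (region d (multiples G))" using semistable_imp_tileable by simp
  next
    assume "tileable (region d (multiples G)) \<and> semistable"
    then show "over = 0" using over_0 by simp
  qed
qed

end
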